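(* Let $m,n\ge 0$ be integers. The $m$-lighted $n$-shade coarsening lattice is isomorphic to the face lattice of a polytope, the $(m,n)$-Hochschild polytope $\mathrm{Hoch}(m,n)\subset\mathbb{R}^{m+n}$, which is defined equivalently (i.e. the two following sets coincide) as (i) the convex hull of the points $\boldsymbol{a}(\mathbb{S})$ (which are its vertices) for all unary $m$-lighted $n$-shades $\mathbb{S}$; (ii) the intersection of the hyperplane $\mathbb{H}_{m+n}$ with the halfspaces $\boldsymbol{H}(\mathbb{S})$ for all $m$-lighted $n$-shades $\mathbb{S}$ of rank $m+n-2$.
   Context: Write $[k]=\{1,\dots,k\}$. **Shades.** An $m$-lighted $n$-shade $\mathbb{S}$ is a pair of sequences $S=(s_1,\dots,s_\ell)$ and $(c_1,\dots,c_\ell)$ of the same length $\ell\ge 0$, where each $s_i$ is a (possibly empty) tuple of positive integers, the sum of all entries of all the tuples is $n$, the $c_i$ are pairwise disjoint (possibly empty) subsets of $[m]$ with union $[m]$, and $c_i\neq\varnothing$ whenever $s_i$ is the empty tuple. The sequences are read from top to bottom ("below" means larger index). An index $i$ with $c_i\ne\varnothing$ is called a cut, with labels $c_i$. Put $|S|=\ell$ and $\|S\|=\sum_i|s_i|$, where $|s_i|$ is the length of the tuple $s_i$. The rank of $\mathbb{S}$ is $m-|S|+\|S\|$. $\mathbb{S}$ is unary if it has rank $0$, i.e. for each $i$, either $s_i$ is empty and $c_i$ is a singleton, or $c_i=\varnothing$ and $s_i$ has exactly one entry. **Preposet.** For an entry $x$ of $s_i$, the preceding sum $ps(x)$ is $m$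 plus the sum of all entries of $s_1,\dots,s_{i-1}$ plus the sum of the entries of $s_i$ weakly before $x$. The range of $s_i$ is $r(s_i)=\{u+1,\dots,v\}$, where $u$ (resp. $v$) is $m$ plus the sum of all entries of $s_1,\dots,s_{i-1}$ (resp. $s_1,\dots,s_i$). Let $N(s_i)=c_i\cup\{ps(x): x \text{ entry of } s_i\}$ and $M(s_i)=r(s_i)\setminus N(s_i)$. Consider the directed graph with one node $N(s_i)$ for each $i$, one node $\{j\}$ for each $j\in\bigcup_i M(s_i)$, and arcs $\{j\}\to N(s_i)$ for $j\in M(s_i)$ and $N(s_{i+1})\to N(s_i)$. The preposet $\preccurlyeq_{\mathbb{S}}$ on $[m+n]$ is defined by $a\preccurlyeq_{\mathbb{S}}b$ iff there is a (possibly empty) directed path from the node containing $a$ to the node containing $b$. **Coarsening lattice.** The coarsening poset on all $m$-lighted $n$-shades is $\mathbb{S}\le\mathbb{S}'$ iff ${\preccurlyeq_{\mathbb{S}}}\subseteq{\preccurlyeq_{\mathbb{S}'}}$. The coarsening lattice is obtained from it by adding a bottom element (corresponding to the empty face). **Points.** Let $\mathbb{S}$ be unary, with values $s_1,\dots,s_r$ of its one-entry tuples from top to bottom. The point $\boldsymbol{a}(\mathbb{S})\in\mathbb{R}^{m+n}$ has $p$-th coordinate: if $p\le m$, the number of cuts weakly below the cut labeled $p$ plus the sum of the entries $s_i$ below the cut labeled $p$; if $p=ps(s_j)$ for some $j\in[r]$, $1+s_j(m+n-p+c_p)+\binom{s_j}{2}$, where $c_p$ is the number of cuts below $s_j$;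 and $1$ otherwise. **Hyperplane and halfspaces.** $\mathbb{H}_{m+n}=\{\boldsymbol{x}\in\mathbb{R}^{m+n}:\sum_i x_i=\binom{m+n+1}{2}\}$. For $\mathbb{S}$ of rank $m+n-2$, $\boldsymbol{H}(\mathbb{S})=\{\boldsymbol{x}\in\mathbb{R}^{m+n}:\sum_{i\in A\cup B}x_i\ge\binom{|A|+|B|+1}{2}\}$, where $A\subseteq[m]$ is the set of labels of the cut not containing the first tuple of $S$ ($A=\varnothing$ if there is no such cut), and $B=\{m+q\}$ if $S$ is a single tuple (all of whose entries are then $1$ except one entry $2$) with the $2$ in position $q$, while $B=\{m+q+1,\dots,m+n\}$ if $S=(s_1,s_2)$ is a pair of tuples with $|s_1|=q$. *)

theory Defs
  imports "HOL-Analysis.Analysis" "HOL-Analysis.Finite_Function_Topology" "HOL-Algebra.Lattice"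
begin

section \<open>Shades\<close>

text \<open>
  The \<open>i\<close>-th entry (counted from \<open>0\<close>, from top to bottom) of a shade is the pair \<open>(s\<^sub>i, c\<^sub>i)\<close>.
\<close>
type_synonym shade = "(nat list \<times> nat set) list"

abbreviation tuple_at :: "shade \<Rightarrow> nat \<Rightarrow> nat list"
  where "tuple_at S i \<equiv> fst (S ! i)"

abbreviation labels_at :: "shade \<Rightarrow> nat \<Rightarrow> nat set"
  where "labels_at S i \<equiv> snd (S ! i)"

definition entry_sum :: "shade \<Rightarrow> nat"
  where "entry_sum S = (\<Sum>(s, c) \<leftarrow> S. sum_list s)"

definition shades :: "nat \<Rightarrow> nat \<Rightarrow> shade set"
  where "shades m n = {S.
     (\<forall>(s, c) \<in> set S. (\<forall>x \<in> set s. 0 < x) \<and> (s = [] \<longrightarrow> c \<noteq> {})) \<and>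
     entry_sum S = n \<and>
     (\<forall>i < length S. \<forall>j < length S. i \<noteq> j \<longrightarrow> labels_at S i \<inter> labels_at S j = {}) \<and>
     (\<Union>(s, c) \<in> set S. c) = {1..m}}"

definition shade_rank :: "nat \<Rightarrow> shade \<Rightarrow> int"
  where "shade_rank m S = int m - int (length S) + (\<Sum>(s, c) \<leftarrow> S. int (length s))"

definition unary_shades :: "nat \<Rightarrow> nat \<Rightarrow> shade set"
  where "unary_shades m n = {S \<in> shades m n. shade_rank m S = 0}"


section \<open>The preposet of a shade\<close>

text \<open>The preceding sum of the entry of index \<open>k\<close> (counted from \<open>0\<close>) of the tuple \<open>s\<^sub>i\<close>.\<close>
definition preceding_sum :: "nat \<Rightarrow> shade \<Rightarrow> nat \<Rightarrow> nat \<Rightarrow> nat"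
  where "preceding_sum m S i k = m + entry_sum (take i S) + sum_list (take (Suc k) (tuple_at S i))"

definition tuple_range :: "nat \<Rightarrow> shade \<Rightarrow> nat \<Rightarrow> nat set"
  where "tuple_range m S i = {m + entry_sum (take i S) + 1 .. m + entry_sum (take (Suc i) S)}"

definition main_node :: "nat \<Rightarrow> shade \<Rightarrow> nat \<Rightarrow> nat set"
  where "main_node m S i =
    labels_at S i \<union> {preceding_sum m S i k | k. k < length (tuple_at S i)}"

definition missing :: "nat \<Rightarrow> shade \<Rightarrow> nat \<Rightarrow> nat set"
  where "missing m S i = tuple_range m S i - main_node m S i"

definition nodes :: "nat \<Rightarrow> shade \<Rightarrow> nat set set"
  where "nodes m S =
    {main_node m S i | i. i < length S} \<union> {{j} | i j. i < length S \<and> j \<in> missing m S i}"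

definition arcs :: "nat \<Rightarrow> shade \<Rightarrow> (nat set \<times> nat set) set"
  where "arcs m S =
    {({j}, main_node m S i) | i j. i < length S \<and> j \<in> missing m S i} \<union>
    {(main_node m S (Suc i), main_node m S i) | i. Suc i < length S}"

definition preposet :: "nat \<Rightarrow> shade \<Rightarrow> (nat \<times> nat) set"
  where "preposet m S =
    {(a, b). \<exists>X \<in> nodes m S. \<exists>Y \<in> nodes m S. a \<in> X \<and> b \<in> Y \<and> (X, Y) \<in> (arcs m S)\<^sup>*}"


section \<open>Coarsening lattice, face lattice, isomorphism\<close>

text \<open>\<open>None\<close> is the added bottom element.\<close>
fun coarsening_le :: "nat \<Rightarrow> shade option \<Rightarrow> shade option \<Rightarrow> bool"
  where
    "coarsening_le m None T \<longleftrightarrow> True"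
  | "coarsening_le m (Some S) None \<longleftrightarrow> False"
  | "coarsening_le m (Some S) (Some T) \<longleftrightarrow> preposet m S \<subseteq> preposet m T"

definition coarsening_lattice :: "nat \<Rightarrow> nat \<Rightarrow> shade option gorder"
  where "coarsening_lattice m n =
    \<lparr>carrier = insert None (Some ` shades m n), eq = (=), le = coarsening_le m\<rparr>"

text \<open>For \<^const>\<open>face_of\<close>, the empty set and the whole polytope are faces, and the faces of a
  polytope are its exposed faces.\<close>
definition face_lattice :: "'a::real_vector set \<Rightarrow> 'a set gorder"
  where "face_lattice P = \<lparr>carrier = {F. F face_of P}, eq = (=), le = (\<subseteq>)\<rparr>"

definition order_isomorphic :: "'a gorder \<Rightarrow> 'b gorder \<Rightarrow> bool"
  where "order_isomorphic L M \<longleftrightarrow>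
    (\<exists>f. bij_betw f (carrier L) (carrier M) \<and> order_emb L M f)"


section \<open>Points, hyperplane and halfspaces\<close>

text \<open>
  \<open>\<real>\<^sup>d\<close>, for all \<open>d \<ge> 0\<close>, is the space of real functions supported on \<open>{1..d}\<close>, inside the real
  vector space of finitely supported functions on \<^typ>\<open>nat\<close>.
\<close>
definition coord_space :: "nat \<Rightarrow> (nat \<Rightarrow>\<^sub>0 real) set"
  where "coord_space d = {x. Poly_Mapping.keys x \<subseteq> {1..d}}"

definition cuts_from :: "shade \<Rightarrow> nat \<Rightarrow> nat"
  where "cuts_from S i = card {j. i \<le> j \<and> j < length S \<and> labels_at S j \<noteq> {}}"

text \<open>
  Only meant for unary \<open>S\<close> and \<open>p \<in> {1..m + n}\<close>; then a nonempty tuple has a single entry, of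
  index \<open>0\<close>, the indices described by \<open>THE\<close> exist uniquely, and \<open>m + n - p\<close> is not truncated.
\<close>
definition point_coord :: "nat \<Rightarrow> nat \<Rightarrow> shade \<Rightarrow> nat \<Rightarrow> nat"
  where "point_coord m n S p =
    (if p \<le> m then
       let i = (THE i. i < length S \<and> p \<in> labels_at S i)
       in cuts_from S i + entry_sum (drop (Suc i) S)
     else if \<exists>j < length S. tuple_at S j \<noteq> [] \<and> p = preceding_sum m S j 0 then
       let j = (THE j. j < length S \<and> tuple_at S j \<noteq> [] \<and> p = preceding_sum m S j 0);
           s = hd (tuple_at S j)
       in 1 + s * (m + n - p + cuts_from S (Suc j)) + (s choose 2)
     else 1)"

definition shade_point :: "nat \<Rightarrow> nat \<Rightarrow> shade \<Rightarrow> (nat \<Rightarrow>\<^sub>0 real)"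
  where "shade_point m n S =
    (\<Sum>p = 1..m + n. Poly_Mapping.single p (real (point_coord m n S p)))"

definition sum_hyperplane :: "nat \<Rightarrow> (nat \<Rightarrow>\<^sub>0 real) set"
  where "sum_hyperplane d =
    {x \<in> coord_space d. (\<Sum>i = 1..d. Poly_Mapping.lookup x i) = real ((d + 1) choose 2)}"

text \<open>
  The sets \<open>A\<close> and \<open>B\<close> of a shade of rank \<open>m + n - 2\<close>. Such a shade has one or two tuples, so
  \<open>A\<close> is the set of labels attached to the second tuple, if any.
\<close>
definition lower_labels :: "shade \<Rightarrow> nat set"
  where "lower_labels S = (\<Union>(s, c) \<in> set (tl S). c)"

definition lower_positions :: "nat \<Rightarrow> nat \<Rightarrow> shade \<Rightarrow> nat set"
  where "lower_positions m n S =
    (if length S = 1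
     then {m + q | q. 1 \<le> q \<and> q \<le> length (tuple_at S 0) \<and> tuple_at S 0 ! (q - 1) = 2}
     else {m + length (tuple_at S 0) + 1 .. m + n})"

definition shade_halfspace :: "nat \<Rightarrow> nat \<Rightarrow> shade \<Rightarrow> (nat \<Rightarrow>\<^sub>0 real) set"
  where "shade_halfspace m n S =
    (let A = lower_labels S; B = lower_positions m n S
     in {x \<in> coord_space (m + n).
          (\<Sum>i \<in> A \<union> B. Poly_Mapping.lookup x i) \<ge> real ((card A + card B + 1) choose 2)})"


section \<open>The two descriptions of the Hochschild polytope\<close>

definition hochschild_hull :: "nat \<Rightarrow> nat \<Rightarrow> (nat \<Rightarrow>\<^sub>0 real) set"
  where "hochschild_hull m n = convex hull (shade_point m n ` unary_shades m n)"

definition hochschild_halfspaces :: "nat \<Rightarrow> nat \<Rightarrow> (nat \<Rightarrow>\<^sub>0 real) set"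
  where "hochschild_halfspaces m n =
    sum_hyperplane (m + n) \<inter>
    (\<Inter>S \<in> {S \<in> shades m n. shade_rank m S = int m + int n - 2}. shade_halfspace m n S)"

end

theory Submission
  imports Defs
begin

text \<open>
  Call a subset of \<open>{1..m + n}\<close> final if with a position \<open>p > m\<close> it contains all later positions.
  A shade amounts to a chain of final sets (the unions of the blocks of its final segments) together
  with a set of marked positions (the elements of the sets \<open>M(s\<^sub>i)\<close>), no marked position lying just
  above a member of the chain. In these terms \<open>S \<le> T\<close> means that the chain and the marked positions
  of \<open>T\<close> are contained in those of \<open>S\<close>.

  The halfspaces say that the coordinates in a final set \<open>U\<close> sum to at least \<open>|U| (|U| + 1) / 2\<close> and
  that every coordinate is at least \<open>1\<close>. By strict supermodularity of the bounds, the tight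
  constraints at a point form the data of a shade. Conversely, each shade is realized by a point: every
  element of a block gets the average value of the block, except that marked positions get \<open>1\<close> and
  the last position of the block takes up the difference. For unary shades this point is
  \<open>a(S)\<close>, the only point of its face; at any other point two elements of the same main node span a
  direction along which one can move both ways until a new constraint becomes tight. Hence the polyhedron
  is the hull of the points \<open>a(S)\<close>, and its faces correspond to the sets of tight constraints.
\<close>

section \<open>Faces of an intersection of finitely many halfspaces\<close>

text \<open>Shades are compared through a directed graph, faces through tight constraints; the pair
  (chain, marked positions) can be read off from both. On the side of the preposet, the members of
  the chain are its final lower sets, and a position \<open>q\<close> before the last one is marked
  iff \<open>q + 1\<close> is not below \<open>q\<close>. The main obstacle is a point at which
  exactly the prescribed constraints are tight. Tightness on the chain dictates the averages: with
  \<open>b\<close> elements in the later blocks and \<open>t\<close> in the block itself, the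
  average is \<open>(T(b + t) - T(b)) / t = b + (t + 1) / 2\<close>, where
  \<open>T(j) = j (j + 1) / 2\<close>. By convexity of \<open>T\<close>, a final set cutting through
  a block then stays strictly above its bound. Lowering the marked positions to 1 does not spoil
  this, because a final set that meets a marked position also contains the last position of that
  block, where the loss is made up. For a single entry \<open>x\<close> this last value is
  \<open>1 + x b + x (x - 1) / 2\<close>, which explains the binomial coefficient in
  \<open>a(S)\<close>.\<close>

locale polyhedron =
  fixes E :: "'a::real_vector set" and I :: "'i set"
    and f :: "'i \<Rightarrow> 'a \<Rightarrow> real" and c :: "'i \<Rightarrow> real"
  assumes finite_I: "finite I" and linear_f: "linear (f i)" and affine_E: "affine E"
begin

definition pts :: "'a set"
  where "pts = {x \<in> E. \<forall>i\<in>I. c i \<le> f i x}"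

definition tight :: "'a \<Rightarrow> 'i set"
  where "tight x = {i \<in> I. f i x = c i}"

definition face :: "'i set \<Rightarrow> 'a set"
  where "face J = {x \<in> pts. J \<subseteq> tight x}"

lemma f_lin [simp]: "f i (x + y) = f i x + f i y" "f i (x - y) = f i x - f i y"
  "f i (r *\<^sub>R x) = r * f i x" "f i 0 = 0" "f i (- x) = - f i x"
  using linear_f[of i] by (simp_all add: linear_add linear_diff linear_cmul linear_0 linear_neg)

lemma convex_pts: "convex pts"
proof (rule convexI)
  fix x y :: 'a and u v :: real
  assume h: "x \<in> pts" "y \<in> pts" "0 \<le> u" "0 \<le> v" "u + v = 1"
  have "c i \<le> u * f i x + v * f i y" if "i \<in> I" for i
  proof -
    have "u * c i + v * c i \<le> u * f i x + v * f i y"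
      using h that by (intro add_mono mult_left_mono) (auto simp: pts_def)
    then show ?thesis using h(5) by (metis distrib_right mult_1)
  qed
  moreover have "u *\<^sub>R x + v *\<^sub>R y \<in> E"
    using h affine_E by (auto simp: pts_def affine_def)
  ultimately show "u *\<^sub>R x + v *\<^sub>R y \<in> pts" by (simp add: pts_def)
qed

lemma face_of_face: "face J face_of pts"
  unfolding face_of_def
proof (intro conjI ballI impI)
  show "face J \<subseteq> pts" by (auto simp: face_def)
  show "convex (face J)"
  proof (rule convexI)
    fix x y :: 'a and u v :: real
    assume h: "x \<in> face J" "y \<in> face J" "0 \<le> u" "0 \<le> v" "u + v = 1"
    have "f i (u *\<^sub>R x + v *\<^sub>R y) = c i" if "i \<in> J" for i
    proof -
      have "f i x = c i" "f i y = c i" using h that by (auto simp: face_def tight_def)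
      then show ?thesis using h(5) by simp (metis distrib_right mult_1)
    qed
    moreover have "u *\<^sub>R x + v *\<^sub>R y \<in> pts"
      using h convex_pts by (auto simp: face_def intro: convexD)
    moreover have "J \<subseteq> I" using h by (auto simp: face_def tight_def)
    ultimately show "u *\<^sub>R x + v *\<^sub>R y \<in> face J" by (auto simp: face_def tight_def)
  qed
next
  fix a b x assume ab: "a \<in> pts" "b \<in> pts" "x \<in> face J" "x \<in> open_segment a b"
  then obtain u where u: "0 < u" "u < 1" "x = (1 - u) *\<^sub>R a + u *\<^sub>R b"
    by (auto simp: in_segment)
  have *: "f i a = c i \<and> f i b = c i" if "i \<in> J" for i
  proof -
    have iI: "i \<in> I" and eq: "f i x = c i" using that ab by (auto simp: face_def tight_def)
    have ge: "f i a - c i \<ge> 0" "f i b - c i \<ge> 0" using ab iI by (auto simp: pts_def)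
    have "(1 - u) * (f i a - c i) + u * (f i b - c i) = 0"
      using eq u(3) by (simp add: algebra_simps)
    moreover have "(1 - u) * (f i a - c i) \<ge> 0" "u * (f i b - c i) \<ge> 0"
      using ge u by (auto intro: mult_nonneg_nonneg)
    ultimately have "(1 - u) * (f i a - c i) = 0" "u * (f i b - c i) = 0" by linarith+
    then show ?thesis using u by simp
  qed
  have "J \<subseteq> I" using ab by (auto simp: face_def tight_def)
  with * ab show "a \<in> face J" "b \<in> face J" by (auto simp: face_def tight_def)
qed

text \<open>Constraints tight at \<open>x\<close> are constant on the line through \<open>x\<close>
  and \<open>y\<close>; the finitely many others are slack at \<open>x\<close> and survive a small
  step away from \<open>y\<close>.\<close>

lemma push_beyond:
  assumes x: "x \<in> pts" and y: "y \<in> pts" and T: "tight x \<subseteq> tight y"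
  shows "\<exists>e>0. x + e *\<^sub>R (x - y) \<in> pts"
proof -
  have "\<forall>\<^sub>F e in at_right 0. c i \<le> f i x + e * (f i x - f i y)" if "i \<in> I" for i
  proof (cases "i \<in> tight x")
    case True
    then have "f i x = c i" "f i y = c i" using T by (auto simp: tight_def)
    then show ?thesis by simp
  next
    case False
    then have "c i < f i x" using that x by (fastforce simp: tight_def pts_def)
    moreover have "((\<lambda>e. f i x + e * (f i x - f i y)) \<longlongrightarrow> f i x + 0 * (f i x - f i y)) (at_right 0)"
      by (intro tendsto_intros)
    ultimately have "\<forall>\<^sub>F e in at_right 0. c i < f i x + e * (f i x - f i y)"
      by (auto dest: order_tendstoD(1))
    then show ?thesis by (rule eventually_mono) simp
  qed
  then have "\<forall>\<^sub>F e in at_right (0::real). (\<forall>i\<in>I. c i \<le> f i x + e * (f i x - f i y)) \<and> 0 < e"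
    by (intro eventually_conj eventually_ball_finite finite_I ballI eventually_at_right_less)
  then obtain e where e: "\<forall>i\<in>I. c i \<le> f i x + e * (f i x - f i y)" "e > 0"
    using eventually_happens[of _ "at_right (0::real)"] by fastforce
  have "(1 + e) *\<^sub>R x + (- e) *\<^sub>R y \<in> E"
    using affine_E x y unfolding affine_def pts_def by (metis (no_types, lifting) add_uminus_conv_diff
        add_diff_cancel_right' mem_Collect_eq)
  then have "x + e *\<^sub>R (x - y) \<in> E" by (simp add: algebra_simps)
  with e show ?thesis by (auto simp: pts_def)
qed

text \<open>By \<open>push_beyond\<close>, \<open>x\<close> lies strictly between \<open>y\<close>
  and another point of the polyhedron, so a face containing \<open>x\<close> contains
  \<open>y\<close>.\<close>

lemma face_of_absorbs:
  assumes F: "F face_of pts" and x: "x \<in> F" and y: "y \<in> pts" and T: "tight x \<subseteq> tight y"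
  shows "y \<in> F"
proof (cases "x = y")
  case False
  have xP: "x \<in> pts" using F x by (auto simp: face_of_def)
  obtain e where e: "e > 0" "x + e *\<^sub>R (x - y) \<in> pts" using push_beyond[OF xP y T] by blast
  let ?z = "x + e *\<^sub>R (x - y)"
  \<comment> \<open>Solves \<open>?z = (1 + e) x - e y\<close> for \<open>x\<close>.\<close>
  have "x = (1 - 1 / (1 + e)) *\<^sub>R y + (1 / (1 + e)) *\<^sub>R ?z"
  proof -
    have "(1 + e) *\<^sub>R x = (1 + e) *\<^sub>R ((1 - 1 / (1 + e)) *\<^sub>R y + (1 / (1 + e)) *\<^sub>R ?z)"
      using e(1) by (simp add: scaleR_add_right) (simp add: algebra_simps)
    then show ?thesis using e(1) by (subst (asm) scaleR_cancel_left) auto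
  qed
  moreover have "y \<noteq> ?z"
  proof
    assume "y = ?z"
    then have "(1 + e) *\<^sub>R (x - y) = 0" by (simp add: algebra_simps)
    then show False using e False by auto
  qed
  ultimately have "x \<in> open_segment y ?z"
    unfolding in_segment using e(1) by (intro conjI exI[of _ "1 / (1 + e)"]) auto
  then show ?thesis using F x y e unfolding face_of_def by blast
qed (use x in simp)

text \<open>Slacks are nonnegative, so their average vanishes only if both vanish.\<close>

lemma tight_midpoint:
  assumes "x \<in> pts" "y \<in> pts"
  shows "tight (midpoint x y) = tight x \<inter> tight y"
proof -
  have "f i (midpoint x y) = c i \<longleftrightarrow> f i x = c i \<and> f i y = c i" if "i \<in> I" for i
    using assms that by (fastforce simp: midpoint_def pts_def)
  then show ?thesis by (auto simp: tight_def)
qed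

text \<open>A point of \<open>F\<close> with the fewest tight constraints has only those shared by
  all of \<open>F\<close>: the midpoint with another point of \<open>F\<close> would otherwise have
  fewer. \<open>face_of_absorbs\<close> then gives the converse inclusion.\<close>

lemma face_of_cases:
  assumes F: "F face_of pts" and ne: "F \<noteq> {}"
  obtains x where "x \<in> pts" "F = face (tight x)"
proof -
  obtain x where x: "x \<in> F" and min: "\<And>z. z \<in> F \<Longrightarrow> card (tight x) \<le> card (tight z)"
    using ex_has_least_nat[of "\<lambda>x. x \<in> F" _ "\<lambda>x. card (tight x)"] ne by blast
  have FP: "F \<subseteq> pts" and cF: "convex F" using F by (auto simp: face_of_def)
  have "tight x \<subseteq> tight z" if z: "z \<in> F" for z
  proof -
    have "midpoint x z \<in> F" using cF x z by (metis convex_contains_segment midpoint_in_closed_segment subsetD)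
    then have "card (tight x) \<le> card (tight x \<inter> tight z)"
      using min tight_midpoint x z FP by (metis subsetD)
    moreover have "finite (tight x)" using finite_I by (simp add: tight_def)
    ultimately have "tight x \<inter> tight z = tight x"
      by (metis card_subset_eq inf.cobounded1 card_mono order_antisym)
    then show ?thesis by blast
  qed
  then have "F = face (tight x)"
    using face_of_absorbs[OF F x] FP by (auto simp: face_def)
  then show ?thesis using that x FP by blast
qed

text \<open>The ratio test: \<open>b\<close> is the first time at which a constraint decreasing
  along \<open>v\<close> becomes tight. The constraints already tight do not change along
  \<open>v\<close>, so the gain is strict.\<close>

lemma ray_hits_facet:
  assumes x: "x \<in> pts" and E: "\<And>t. x + t *\<^sub>R v \<in> E"
    and T: "\<And>i. i \<in> tight x \<Longrightarrow> f i v = 0" and neg: "\<exists>i\<in>I. f i v < 0"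
  shows "\<exists>b>0. x + b *\<^sub>R v \<in> pts \<and> tight x \<subset> tight (x + b *\<^sub>R v)"
proof -
  let ?N = "{i\<in>I. f i v < 0}"
  let ?r = "\<lambda>i. (f i x - c i) / (- f i v)"
  define b where "b = Min (?r ` ?N)"
  have fin: "finite (?r ` ?N)" "?r ` ?N \<noteq> {}" using finite_I neg by auto
  have pos: "?r i > 0" if "i \<in> ?N" for i
  proof -
    have "f i x \<noteq> c i" using T that by (force simp: tight_def)
    then have "f i x > c i" using x that by (force simp: pts_def)
    then have "0 < f i x - c i" "0 < - f i v" using that by auto
    then show ?thesis by (rule divide_pos_pos)
  qed
  have b: "b > 0" using fin pos by (simp add: b_def)
  have ble: "b \<le> ?r i" if "i \<in> ?N" for i using fin that by (auto simp: b_def)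
  obtain j where j: "j \<in> ?N" "b = ?r j" using Min_in[OF fin] b_def by auto
  have "c i \<le> f i x + b * f i v" if "i \<in> I" for i
  proof (cases "f i v < 0")
    case True
    then show ?thesis using ble[of i] that by (simp add: field_simps)
  next
    case False
    then have "b * f i v \<ge> 0" using b by simp
    then show ?thesis using x that by (force simp: pts_def)
  qed
  then have 1: "x + b *\<^sub>R v \<in> pts" using E by (simp add: pts_def)
  have 2: "tight x \<subseteq> tight (x + b *\<^sub>R v)" using T by (auto simp: tight_def)
  have "f j (x + b *\<^sub>R v) = c j" using j by (simp add: field_simps)
  then have 3: "j \<in> tight (x + b *\<^sub>R v)" using j by (simp add: tight_def)
  have "j \<notin> tight x" using j T by force
  then show ?thesis using b 1 2 3 by blast
qed

text \<open>Induction on the number of slack constraints: a point outside \<open>V\<close> lies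
  between the two points where its line in direction \<open>v\<close> leaves the polyhedron, and
  both have more tight constraints.\<close>

lemma pts_subset_hull:
  assumes step: "\<And>x. x \<in> pts \<Longrightarrow> x \<in> V \<or>
    (\<exists>v. (\<forall>t. x + t *\<^sub>R v \<in> E) \<and> (\<forall>i\<in>tight x. f i v = 0) \<and> (\<exists>i\<in>I. f i v < 0) \<and> (\<exists>i\<in>I. f i v > 0))"
  shows "pts \<subseteq> convex hull V"
proof
  fix x assume "x \<in> pts"
  then show "x \<in> convex hull V"
  proof (induction "card (I - tight x)" arbitrary: x rule: less_induct)
    case less
    have smaller: "card (I - tight y) < card (I - tight x)" if "tight x \<subset> tight y" for y
      using that finite_I by (intro psubset_card_mono) (auto simp: tight_def)
    show ?case
    proof (cases "x \<in> V")
      case False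
      then obtain v where E: "\<And>t. x + t *\<^sub>R v \<in> E" and T: "\<And>i. i \<in> tight x \<Longrightarrow> f i v = 0"
        and neg: "\<exists>i\<in>I. f i v < 0" and pos: "\<exists>i\<in>I. f i v > 0" using step[OF less.prems] by metis
      obtain b where b: "b > 0" "x + b *\<^sub>R v \<in> pts" "tight x \<subset> tight (x + b *\<^sub>R v)"
        using ray_hits_facet[OF less.prems E T neg] by blast
      have "x + t *\<^sub>R (- v) \<in> E" for t using E[of "- t"] by simp
      then obtain a where a: "a > 0" "x + a *\<^sub>R (- v) \<in> pts" "tight x \<subset> tight (x + a *\<^sub>R (- v))"
        using ray_hits_facet[of x "- v"] less.prems T pos by auto
      have "x + b *\<^sub>R v \<in> convex hull V" "x + a *\<^sub>R (- v) \<in> convex hull V"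
        using less.hyps smaller a b by blast+
      \<comment> \<open>The weights with \<open>p * b = q * a\<close>, which makes the contributions
        of \<open>v\<close> cancel.\<close>
      moreover define p q where pq: "p = a / (a + b)" "q = b / (a + b)"
      have *: "p + q = 1" "p * b = q * a" "p \<ge> 0" "q \<ge> 0"
        using a b by (auto simp: pq add_divide_distrib[symmetric])
      have "p *\<^sub>R (x + b *\<^sub>R v) + q *\<^sub>R (x + a *\<^sub>R (- v)) = (p + q) *\<^sub>R x + (p * b - q * a) *\<^sub>R v"
        by (simp add: algebra_simps)
      then have "x = p *\<^sub>R (x + b *\<^sub>R v) + q *\<^sub>R (x + a *\<^sub>R (- v))" using * by simp
      ultimately show ?thesis
        using convexD[OF convex_convex_hull, of "x + b *\<^sub>R v" V "x + a *\<^sub>R (- v)" p q] * by simp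
    qed (simp add: hull_inc)
  qed
qed

end

section \<open>Shades as chains of final sets with marked positions\<close>

definition all_labels :: "shade \<Rightarrow> nat set"
  where "all_labels S = (\<Union>(s, c)\<in>set S. c)"

text \<open>Here and below, \<open>k\<close> is the last position used above the list
  \<open>S\<close>. For a whole shade it is \<open>m\<close>; recursion into a final segment
  increases it by the sum of the tuple passed.\<close>

definition ground :: "nat \<Rightarrow> shade \<Rightarrow> nat set"
  where "ground k S = all_labels S \<union> {k<..k + entry_sum S}"

fun partial_sums :: "nat \<Rightarrow> nat list \<Rightarrow> nat set"
  where
    "partial_sums k [] = {}"
  | "partial_sums k (x # s) = insert (k + x) (partial_sums (k + x) s)"

fun chain :: "nat \<Rightarrow> shade \<Rightarrow> nat set set"
  where
    "chain k [] = {{}}"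
  | "chain k ((s, c) # S) = insert (ground k ((s, c) # S)) (chain (k + sum_list s) S)"

fun marked :: "nat \<Rightarrow> shade \<Rightarrow> nat set"
  where
    "marked k [] = {}"
  | "marked k ((s, c) # S) = ({k<..k + sum_list s} - partial_sums k s) \<union> marked (k + sum_list s) S"

text \<open>The conditions on \<open>shades\<close> apart from the entry sum, in a form suited to
  recursion: \<open>L\<close> holds the labels not yet used, so passing on \<open>L - c\<close>
  encodes disjointness and ending with \<open>L = {}\<close> encodes that all labels occur.\<close>

fun wf_shade :: "nat set \<Rightarrow> shade \<Rightarrow> bool"
  where
    "wf_shade L [] \<longleftrightarrow> L = {}"
  | "wf_shade L ((s, c) # S) \<longleftrightarrow>
      (\<forall>x\<in>set s. 0 < x) \<and> (s = [] \<longrightarrow> c \<noteq> {}) \<and> c \<subseteq> L \<and> wf_shade (L - c) S"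

lemma entry_sum_simps [simp]:
  "entry_sum [] = 0" "entry_sum ((s, c) # S) = sum_list s + entry_sum S"
  by (simp_all add: entry_sum_def)

lemma all_labels_simps [simp]:
  "all_labels [] = {}" "all_labels ((s, c) # S) = c \<union> all_labels S"
  by (auto simp: all_labels_def)

lemma ground_Nil [simp]: "ground k [] = {}"
  by (simp add: ground_def)

lemma ground_Cons: "ground k ((s, c) # S) = c \<union> {k<..k + sum_list s} \<union> ground (k + sum_list s) S"
  by (auto simp: ground_def)

lemma wf_shade_labels: "wf_shade L S \<Longrightarrow> all_labels S = L"
  by (induction L S rule: wf_shade.induct) auto

lemma wf_shade_iff:
  "wf_shade L S \<longleftrightarrow>
    (\<forall>(s, c) \<in> set S. (\<forall>x \<in> set s. 0 < x) \<and> (s = [] \<longrightarrow> c \<noteq> {})) \<and>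
    (\<forall>i < length S. \<forall>j < length S. i \<noteq> j \<longrightarrow> labels_at S i \<inter> labels_at S j = {}) \<and>
    all_labels S = L"
proof (induction S arbitrary: L)
  case (Cons a S)
  obtain s c where a: "a = (s, c)" by force
  have 1: "(\<forall>i < length (a # S). \<forall>j < length (a # S). i \<noteq> j \<longrightarrow>
      labels_at (a # S) i \<inter> labels_at (a # S) j = {}) \<longleftrightarrow>
    (\<forall>j < length S. c \<inter> labels_at S j = {}) \<and>
    (\<forall>i < length S. \<forall>j < length S. i \<noteq> j \<longrightarrow> labels_at S i \<inter> labels_at S j = {})"
    by (simp add: a All_less_Suc2) blast
  have 2: "(\<forall>j < length S. c \<inter> labels_at S j = {}) \<longleftrightarrow> c \<inter> all_labels S = {}"
  proof -
    have "(\<forall>j < length S. c \<inter> labels_at S j = {}) \<longleftrightarrow> (\<forall>x\<in>set S. c \<inter> snd x = {})"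
      by (simp add: all_set_conv_all_nth)
    then show ?thesis by (auto simp: all_labels_def split_beta)
  qed
  show ?case
    unfolding 1 2 using Cons.IH[of "L - c"] by (auto simp: a)
qed auto

lemma shades_iff: "S \<in> shades m n \<longleftrightarrow> wf_shade {1..m} S \<and> entry_sum S = n"
  unfolding shades_def wf_shade_iff all_labels_def by auto

section \<open>Tuples of positive integers and their sets of partial sums\<close>

lemma partial_sums_subset: "\<forall>x\<in>set s. 0 < x \<Longrightarrow> partial_sums k s \<subseteq> {k<..k + sum_list s}"
  by (induction k s rule: partial_sums.induct) fastforce+

lemma sum_list_in_partial_sums: "s \<noteq> [] \<Longrightarrow> k + sum_list s \<in> partial_sums k s"
proof (induction k s rule: partial_sums.induct)
  case (2 k x s)
  then show ?case by (cases "s = []") (auto simp: add.assoc)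
qed simp

text \<open>The least partial sum reveals the first entry; the rest follows by recursion.\<close>

lemma partial_sums_inj:
  assumes "\<forall>x\<in>set s. 0 < x" "\<forall>x\<in>set t. 0 < x" "partial_sums k s = partial_sums k t"
  shows "s = t"
  using assms
proof (induction s arbitrary: k t)
  case Nil
  then show ?case by (cases t) auto
next
  case (Cons x s)
  then obtain y t' where t: "t = y # t'" by (cases t) auto
  have sub: "partial_sums (k + x) s \<subseteq> {k + x<..}" "partial_sums (k + y) t' \<subseteq> {k + y<..}"
    using partial_sums_subset[of s "k + x"] partial_sums_subset[of t' "k + y"] Cons.prems t by auto
  have eq: "insert (k + x) (partial_sums (k + x) s) = insert (k + y) (partial_sums (k + y) t')"
    using Cons.prems t by simp
  have xy: "x = y"
  proof (rule ccontr)
    assume "x \<noteq> y"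
    then have "k + x \<in> partial_sums (k + y) t'" "k + y \<in> partial_sums (k + x) s"
      using eq by (metis add_left_cancel insertE insertI1)+
    then show False using sub by fastforce
  qed
  moreover have "partial_sums (k + x) s = partial_sums (k + x) t'"
    using eq sub unfolding xy by (subst (asm) insert_ident) auto
  ultimately show ?case using Cons t by auto
qed

text \<open>The entries are the successive gaps in \<open>X\<close>. The end \<open>e\<close> has to
  be in \<open>X\<close> because the total of a nonempty tuple is one of its partial sums.\<close>

lemma partial_sums_surj:
  assumes "X \<subseteq> {k<..e}" "k \<le> e" "k < e \<Longrightarrow> e \<in> X"
  shows "\<exists>s. (\<forall>x\<in>set s. 0 < x) \<and> k + sum_list s = e \<and> partial_sums k s = X"
  using assms
proof (induction "e - k" arbitrary: k X rule: less_induct)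
  case less
  show ?case
  proof (cases "k = e")
    case True
    then show ?thesis using less.prems by (intro exI[of _ "[]"]) auto
  next
    case False
    then have eX: "e \<in> X" using less.prems by auto
    have fX: "finite X" using less.prems finite_subset by blast
    define x where "x = Min X"
    have x: "x \<in> X" "\<And>y. y \<in> X \<Longrightarrow> x \<le> y" 
    proof -
      have "X \<noteq> {}" using eX by blast
      then show "x \<in> X" "\<And>y. y \<in> X \<Longrightarrow> x \<le> y" using fX by (simp_all add: x_def)
    qed
    have ox: "k < x" "x \<le> e" using x less.prems by auto
    have "X - {x} \<subseteq> {x<..e}" using x(2) less.prems by fastforce
    then obtain s where s: "\<forall>y\<in>set s. 0 < y" "x + sum_list s = e" "partial_sums x s = X - {x}"
      using less.hyps[of x "X - {x}"] ox eX diff_less_mono2[of k x e] by auto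
    then show ?thesis using ox x by (intro exI[of _ "(x - k) # s"]) auto
  qed
qed

section \<open>Which chains and marked sets come from shades, and uniqueness of the shade\<close>

definition final :: "nat \<Rightarrow> nat \<Rightarrow> nat set \<Rightarrow> bool"
  where "final k d U \<longleftrightarrow> (\<forall>p q. k < p \<longrightarrow> p \<le> q \<longrightarrow> q \<le> d \<longrightarrow> p \<in> U \<longrightarrow> q \<in> U)"

text \<open>If \<open>Suc q\<close> is in \<open>U\<close> and \<open>q\<close> is not, then
  \<open>q\<close> is the last position of its block, hence a partial sum and not marked: this is
  the last clause. That \<open>d\<close> is not in \<open>Q\<close> is the same condition for the
  member \<open>{}\<close>, which the last clause cannot express.\<close>

definition valid :: "nat \<Rightarrow> nat \<Rightarrow> nat set \<Rightarrow> nat set set \<Rightarrow> nat set \<Rightarrow> bool"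
  where "valid k d L C Q \<longleftrightarrow>
    {} \<in> C \<and> L \<union> {k<..d} \<in> C \<and> (\<forall>U\<in>C. U \<subseteq> L \<union> {k<..d} \<and> final k d U) \<and>
    (\<forall>U\<in>C. \<forall>V\<in>C. U \<subseteq> V \<or> V \<subseteq> U) \<and>
    Q \<subseteq> {k<..<d} \<and> (\<forall>U\<in>C. \<forall>q\<in>Q. Suc q \<in> U \<longrightarrow> q \<in> U)"

lemma chain_subset: "U \<in> chain k S \<Longrightarrow> U \<subseteq> ground k S"
  by (induction k S rule: chain.induct) (auto simp: ground_Cons)

lemma chain_ground: "ground k S \<in> chain k S"
  by (cases "(k, S)" rule: chain.cases) auto

lemma chain_empty: "{} \<in> chain k S"
  by (induction k S rule: chain.induct) auto

lemma ground_eq: "wf_shade L S \<Longrightarrow> ground k S = L \<union> {k<..k + entry_sum S}"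
  by (simp add: ground_def wf_shade_labels)

text \<open>The last position \<open>?e\<close> of the first tuple is a partial sum, so a marked
  \<open>q\<close> of that tuple satisfies \<open>q < ?e\<close> and \<open>Suc q\<close> is still
  in the same block. No member of the chain can therefore separate the two.\<close>

lemma valid_shade:
  assumes "wf_shade L S" "L \<subseteq> {..k}"
  shows "valid k (k + entry_sum S) L (chain k S) (marked k S)"
  using assms
proof (induction k S arbitrary: L rule: chain.induct)
  case (1 k)
  then show ?case by (auto simp: valid_def final_def)
next
  case (2 k s c S)
  let ?e = "k + sum_list s" and ?d = "k + entry_sum ((s, c) # S)"
  have d: "?e + entry_sum S = ?d" by simp
  have wf: "wf_shade (L - c) S" and c: "c \<subseteq> L" and pos: "\<forall>x\<in>set s. 0 < x" and L: "L \<subseteq> {..k}"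
    using 2(2,3) by auto
  have IH: "valid ?e ?d (L - c) (chain ?e S) (marked ?e S)"
    using 2(1)[OF wf] L unfolding d[symmetric] by fastforce
  have top: "ground k ((s, c) # S) = L \<union> {k<..?d}" using ground_eq[OF 2(2)] by simp
  have in_psums: "?e \<in> partial_sums k s" if "k < ?e" using that sum_list_in_partial_sums[of s k] by (cases s) auto
  have U: "U \<subseteq> (L - c) \<union> {?e<..?d}" "final ?e ?d U" if "U \<in> chain ?e S" for U
    using IH that by (auto simp: valid_def)
  have fin: "final k ?d U" if "U \<in> chain ?e S" for U
    unfolding final_def
  proof (intro allI impI)
    fix p q assume p: "k < p" "p \<le> q" "q \<le> ?d" "p \<in> U"
    have "p \<notin> L" using L p(1) by auto
    then have "?e < p" using subsetD[OF U(1)[OF that] p(4)] by auto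
    then show "q \<in> U" using U(2)[OF that] p unfolding final_def by blast
  qed
  have low: "q < ?e" if "q \<in> {k<..?e} - partial_sums k s" for q
    using that in_psums by (cases "q = ?e") auto
  have rest: "marked ?e S \<subseteq> {?e<..<?d}" using IH by (simp add: valid_def)
  have step: "q \<in> U" if "q \<in> marked k ((s, c) # S)" "U \<in> chain ?e S" "Suc q \<in> U" for q U
  proof (cases "q \<in> marked ?e S")
    case True
    then show ?thesis using IH that by (auto simp: valid_def)
  next
    case False
    then have "q < ?e" "k < q" using low that by auto
    then have "Suc q \<notin> L" "Suc q \<le> ?e" using L by auto
    then show ?thesis using subsetD[OF U(1)[OF that(2)] that(3)] by auto
  qed
  show ?case
    unfolding valid_def
  proof (intro conjI)
    show "{} \<in> chain k ((s, c) # S)" by (rule chain_empty)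
    show "L \<union> {k<..?d} \<in> chain k ((s, c) # S)" using top by simp
    show "\<forall>U\<in>chain k ((s, c) # S). U \<subseteq> L \<union> {k<..?d} \<and> final k ?d U"
    proof
      fix U assume "U \<in> chain k ((s, c) # S)"
      then consider "U = L \<union> {k<..?d}" | "U \<in> chain ?e S" using top by auto
      then show "U \<subseteq> L \<union> {k<..?d} \<and> final k ?d U"
      proof cases
        case 2
        then show ?thesis using U(1)[OF 2] fin[OF 2] by fastforce
      qed (auto simp: final_def)
    qed
    have "\<forall>U\<in>chain ?e S. \<forall>V\<in>chain ?e S. U \<subseteq> V \<or> V \<subseteq> U" using IH by (auto simp: valid_def)
    moreover have "\<forall>U\<in>chain ?e S. U \<subseteq> L \<union> {k<..?d}" using U(1) by fastforce
    ultimately show "\<forall>U\<in>chain k ((s, c) # S). \<forall>V\<in>chain k ((s, c) # S). U \<subseteq> V \<or> V \<subseteq> U"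
      unfolding chain.simps top by auto
    have "{k<..?e} - partial_sums k s \<subseteq> {k<..<?d}" using low by fastforce
    moreover have "marked ?e S \<subseteq> {k<..<?d}" using rest by fastforce
    ultimately show marked: "marked k ((s, c) # S) \<subseteq> {k<..<?d}" by simp
    show "\<forall>U\<in>chain k ((s, c) # S). \<forall>q\<in>marked k ((s, c) # S). Suc q \<in> U \<longrightarrow> q \<in> U"
    proof (intro ballI impI)
      fix U q assume U: "U \<in> chain k ((s, c) # S)" and q: "q \<in> marked k ((s, c) # S)" "Suc q \<in> U"
      from U consider "U = L \<union> {k<..?d}" | "U \<in> chain ?e S" using top by auto
      then show "q \<in> U"
      proof cases
        case 1
        then show ?thesis using subsetD[OF marked q(1)] by simp
      qed (use step q in blast)
    qed
  qed
qed

lemma finite_valid: "valid k d L C Q \<Longrightarrow> finite L \<Longrightarrow> finite C"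
  by (rule finite_subset[of _ "Pow (L \<union> {k<..d})"]) (auto simp: valid_def)

lemma final_split:
  assumes "final k d U" "U \<subseteq> L \<union> {k<..d}" "k \<le> d" "L \<subseteq> {..k}"
  shows "\<exists>e. k \<le> e \<and> e \<le> d \<and> U = (U \<inter> L) \<union> {e<..d}"
proof (cases "U \<inter> {k<..d} = {}")
  case True
  then show ?thesis using assms by (intro exI[of _ d]) auto
next
  case False
  define p where "p = Min (U \<inter> {k<..d})"
  have p: "p \<in> U" "k < p" "p \<le> d" using Min_in[OF _ False] by (auto simp: p_def)
  have min: "p \<le> q" if "q \<in> U" "k < q" "q \<le> d" for q using that by (auto simp: p_def)
  have "U = (U \<inter> L) \<union> {p - 1<..d}"
  proof
    show "U \<subseteq> (U \<inter> L) \<union> {p - 1<..d}" using assms(2,4) min p by fastforce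
    show "(U \<inter> L) \<union> {p - 1<..d} \<subseteq> U" using assms(1) p by (fastforce simp: final_def)
  qed
  then show ?thesis using p by (intro exI[of _ "p - 1"]) auto
qed

text \<open>The first block is what the largest proper member \<open>W\<close> leaves out: its
  labels are \<open>L - W\<close>, its positions end at the \<open>e\<close> where \<open>W\<close>
  begins, and its partial sums are its unmarked positions. The remaining chain has one member
  less.\<close>

lemma valid_realizable:
  assumes "valid k d L C Q" "finite L" "L \<subseteq> {..k}" "k \<le> d"
  shows "\<exists>S. wf_shade L S \<and> k + entry_sum S = d \<and> chain k S = C \<and> marked k S = Q"
  using assms
proof (induction "card C" arbitrary: k L C Q rule: less_induct)
  case less
  note V = less.prems(1) and L = less.prems(2,3)
  let ?top = "L \<union> {k<..d}"
  have fC: "finite C" using V L finite_valid by blast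
  have C: "{} \<in> C" "?top \<in> C" "\<And>U. U \<in> C \<Longrightarrow> U \<subseteq> ?top" "\<And>U. U \<in> C \<Longrightarrow> final k d U"
    "\<And>U V. U \<in> C \<Longrightarrow> V \<in> C \<Longrightarrow> U \<subseteq> V \<or> V \<subseteq> U"
    "Q \<subseteq> {k<..<d}" "\<And>U q. U \<in> C \<Longrightarrow> q \<in> Q \<Longrightarrow> Suc q \<in> U \<Longrightarrow> q \<in> U"
    using V by (auto simp: valid_def)
  show ?case
  proof (cases "?top = {}")
    case True
    then have "C = {{}}" "Q = {}" "L = {}" "d = k" using C(1,3,6) less.prems(4) by auto
    then show ?thesis by (intro exI[of _ "[]"]) auto
  next
    case False
    let ?C = "C - {?top}"
    have ne: "?C \<noteq> {}" "finite ?C" using C(1) False fC by auto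
    obtain W where W: "W \<in> ?C" and maxW: "\<And>U. U \<in> ?C \<Longrightarrow> W \<subseteq> U \<Longrightarrow> U = W"
      using finite_has_maximal[OF ne(2,1)] by metis
    then have WC: "W \<in> C" "W \<noteq> ?top" by auto
    have below: "U \<subseteq> W" if "U \<in> ?C" for U using C(5)[of U W] maxW[OF that] that WC by auto
    obtain e where e: "k \<le> e" "e \<le> d" "W = (W \<inter> L) \<union> {e<..d}"
      using final_split[OF C(4)[OF WC(1)] C(3)[OF WC(1)] less.prems(4) L(2)] by blast
    let ?L = "W \<inter> L"
    have "valid e d ?L ?C (Q \<inter> {e<..})"
      unfolding valid_def
    proof (intro conjI ballI impI)
      show "{} \<in> ?C" using C(1) False by auto
      show "?L \<union> {e<..d} \<in> ?C" using W e(3) by simp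
      show "U \<subseteq> ?L \<union> {e<..d}" if "U \<in> ?C" for U using below[OF that] e(3) by simp
      show "final e d U" if "U \<in> ?C" for U using C(4)[of U] that e(1) unfolding final_def by (meson DiffD1 le_less_trans)
      show "U \<subseteq> V \<or> V \<subseteq> U" if "U \<in> ?C" "V \<in> ?C" for U V using C(5) that by blast
      show "Q \<inter> {e<..} \<subseteq> {e<..<d}" using C(6) by auto
      show "q \<in> U" if "U \<in> ?C" "q \<in> Q \<inter> {e<..}" "Suc q \<in> U" for q U using C(7) that by blast
    qed
    moreover have "card ?C < card C" using C(2) fC by (meson card_Diff1_less)
    moreover have "finite ?L" "?L \<subseteq> {..e}" using L e(1) by auto
    ultimately obtain S where S: "wf_shade ?L S" "e + entry_sum S = d" "chain e S = ?C"
        "marked e S = Q \<inter> {e<..}"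
      using less.hyps[of ?C e ?L "Q \<inter> {e<..}"] e(2) by blast
    \<comment> \<open>Needed for \<open>e\<close> to be a partial sum. Either \<open>e = d\<close>,
      which \<open>Q\<close> omits, or \<open>e\<close> lies just above \<open>W\<close>.\<close>
    have "e \<notin> Q" if "k < e"
    proof
      assume "e \<in> Q"
      then have "e < d" using C(6) by auto
      then have "Suc e \<in> (W \<inter> L) \<union> {e<..d}" by auto
      then have "Suc e \<in> W" using e(3) by metis
      then have "e \<in> W" using C(7) \<open>e \<in> Q\<close> WC by blast
      then have "e \<in> (W \<inter> L) \<union> {e<..d}" using e(3) by metis
      then show False using that L(2) by auto
    qed
    then obtain s where s: "\<forall>x\<in>set s. 0 < x" "k + sum_list s = e" "partial_sums k s = {k<..e} - Q"
      using partial_sums_surj[of "{k<..e} - Q" k e] e(1) by auto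
    have "ground k ((s, L - W) # S) = ?top"
      unfolding ground_Cons s(2) ground_eq[OF S(1), of e] S(2) using e(1,2) by auto
    then have "chain k ((s, L - W) # S) = C" using s(2) S(3) C(2) by auto
    moreover have "marked k ((s, L - W) # S) = Q" using s S(4) C(6) by auto
    moreover have "wf_shade L ((s, L - W) # S)"
    proof -
      have "L - W \<noteq> {}" if "s = []"
      proof
        assume "L - W = {}"
        then have "L \<subseteq> W" by auto
        moreover have "e = k" using s(2) that by simp
        ultimately show False using WC(2) e(3) by (metis inf.absorb_iff2)
      qed
      moreover have "L - (L - W) = ?L" by auto
      ultimately show ?thesis using S(1) s(1) by auto
    qed
    moreover have "k + entry_sum ((s, L - W) # S) = d" using s(2) S(2) by simp
    ultimately show ?thesis by blast
  qed
qed

text \<open>The largest member of the chain below the top is the ground set of the tail; it fixes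
  the labels and the range of the first tuple, and the marked positions in that range fix the tuple
  itself.\<close>

lemma shade_inj:
  assumes "wf_shade L S" "wf_shade L T" "L \<subseteq> {..k}" "entry_sum S = entry_sum T"
    "chain k S = chain k T" "marked k S = marked k T"
  shows "S = T"
  using assms
proof (induction k S arbitrary: L T rule: chain.induct)
  case (1 k)
  show ?case
  proof (cases T)
    case (Cons a T')
    obtain s c where "a = (s, c)" by force
    then show ?thesis using 1 Cons by (cases s) auto
  qed simp
next
  case (2 k s c S)
  obtain t b T' where T: "T = (t, b) # T'"
    using 2(2-5) by (cases T; cases s) auto
  let ?e = "k + sum_list s" and ?f = "k + sum_list t"
  let ?d = "k + entry_sum ((s, c) # S)"
  have wf: "wf_shade (L - c) S" "wf_shade (L - b) T'" "c \<subseteq> L" "b \<subseteq> L" using 2(2,3) T by auto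
  have d: "?e + entry_sum S = ?d" "?f + entry_sum T' = ?d" using 2(5) T by auto
  have g: "ground k ((s, c) # S) = L \<union> {k<..?d}" "ground k ((t, b) # T') = L \<union> {k<..?d}"
    using ground_eq[OF 2(2), of k] ground_eq[OF 2(3), of k] 2(5) T by auto
  have gs: "ground ?e S = (L - c) \<union> {?e<..?d}" "ground ?f T' = (L - b) \<union> {?f<..?d}"
    using ground_eq[OF wf(1), of ?e] ground_eq[OF wf(2), of ?f] d by auto
  have ne: "c \<noteq> {} \<or> sum_list s \<noteq> 0" "b \<noteq> {} \<or> sum_list t \<noteq> 0"
    using 2(2,3) T by (cases s; cases t; auto)+
  have lt: "ground ?e S \<noteq> L \<union> {k<..?d}"
  proof
    assume eq: "ground ?e S = L \<union> {k<..?d}"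
    then have "L \<subseteq> L - c" using gs(1) 2(4) by fastforce
    moreover have "?e \<notin> {k<..?d}" using eq gs(1) 2(4) by fastforce
    ultimately show False using wf ne(1) d by fastforce
  qed
  have lt': "ground ?f T' \<noteq> L \<union> {k<..?d}"
  proof
    assume eq: "ground ?f T' = L \<union> {k<..?d}"
    then have "L \<subseteq> L - b" using gs(2) 2(4) by fastforce
    moreover have "?f \<notin> {k<..?d}" using eq gs(2) 2(4) by fastforce
    ultimately show False using wf ne(2) d by fastforce
  qed
  have sub: "ground ?e S \<subseteq> L \<union> {k<..?d}" "ground ?f T' \<subseteq> L \<union> {k<..?d}"
    using gs by auto
  \<comment> \<open>The first blocks are nonempty, so the top is new in both chains and can be
    cancelled from them.\<close>
  have "L \<union> {k<..?d} \<notin> chain ?e S" "L \<union> {k<..?d} \<notin> chain ?f T'"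
    using chain_subset[of _ ?e S] chain_subset[of _ ?f T'] lt lt' sub by (metis subset_antisym)+
  moreover have "insert (L \<union> {k<..?d}) (chain ?e S) = insert (L \<union> {k<..?d}) (chain ?f T')"
    using 2(6) unfolding T chain.simps g .
  ultimately have ch: "chain ?e S = chain ?f T'" by (simp add: insert_ident)
  then have gg: "ground ?e S = ground ?f T'"
    using chain_ground[of ?e S] chain_ground[of ?f T'] chain_subset[of "ground ?e S" ?f T']
      chain_subset[of "ground ?f T'" ?e S] by auto
  have Lc: "L - c = L - b" using gg gs 2(4) by fastforce
  then have cb: "c = b" using wf by blast
  have "{?e<..?d} = {?f<..?d}" using gg gs 2(4) by fastforce
  then have ef: "?e = ?f" using d by (metis card_greaterThanAtMost
        diff_diff_cancel le_add1)
  have in1: "marked ?e S \<subseteq> {?e<..}" "marked ?f T' \<subseteq> {?f<..}"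
    using valid_shade[OF wf(1), of ?e] valid_shade[OF wf(2), of ?f] 2(4)
    by (fastforce simp: valid_def)+
  have eq: "({k<..?e} - partial_sums k s) \<union> marked ?e S = ({k<..?e} - partial_sums k t) \<union> marked ?e T'"
    using 2(7) unfolding T marked.simps ef .
  have "{k<..?e} - partial_sums k s = {k<..?e} - partial_sums k t"
    using arg_cong[OF eq, of "\<lambda>X. X \<inter> {k<..?e}"] in1 ef by auto
  moreover have "partial_sums k s \<subseteq> {k<..?e}" "partial_sums k t \<subseteq> {k<..?e}"
    using partial_sums_subset[of s k] partial_sums_subset[of t k] 2(2,3) T ef by auto
  ultimately have "partial_sums k s = partial_sums k t" by blast
  then have st: "s = t" using partial_sums_inj 2(2,3) T by auto
  have "marked ?e S = (({k<..?e} - partial_sums k s) \<union> marked ?e S) \<inter> {?e<..}"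
    "marked ?e T' = (({k<..?e} - partial_sums k t) \<union> marked ?e T') \<inter> {?e<..}"
    using in1 ef by auto
  then have "marked ?e S = marked ?e T'" using eq by metis
  then have "S = T'" using 2(1)[OF wf(1), of T'] wf cb 2(4,5) st ch T by fastforce
  then show ?case using T st cb by simp
qed

section \<open>The preposet expressed by the chain and the marked positions\<close>

text \<open>A marked \<open>b\<close> is a node without incoming arcs, so only \<open>b\<close>
  itself is below it. Below an unmarked \<open>b\<close> is everything in its own block and in the
  later ones.\<close>

definition chain_preposet :: "nat set \<Rightarrow> nat set set \<Rightarrow> nat set \<Rightarrow> (nat \<times> nat) set"
  where "chain_preposet X C Q =
    {(a, b). a \<in> X \<and> b \<in> X \<and> (a = b \<or> b \<notin> Q \<and> (\<forall>U\<in>C. b \<in> U \<longrightarrow> a \<in> U))}"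

lemma chain_Union_mem:
  assumes "finite A" "A \<noteq> {}" "\<forall>U\<in>A. \<forall>V\<in>A. U \<subseteq> V \<or> V \<subseteq> U"
  shows "\<Union>A \<in> A" "\<Inter>A \<in> A"
proof -
  obtain W where "W \<in> A" "\<And>U. U \<in> A \<Longrightarrow> W \<subseteq> U \<Longrightarrow> U = W" using finite_has_maximal[OF assms(1,2)] by metis
  then have "\<Union>A = W" using assms(3) by blast
  then show "\<Union>A \<in> A" using \<open>W \<in> A\<close> by simp
  obtain W where "W \<in> A" "\<And>U. U \<in> A \<Longrightarrow> U \<subseteq> W \<Longrightarrow> U = W" using finite_has_minimal[OF assms(1,2)] by metis
  then have "\<Inter>A = W" using assms(3) by blast
  then show "\<Inter>A \<in> A" using \<open>W \<in> A\<close> by simp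
qed

text \<open>A final lower set \<open>D\<close> is the union \<open>W\<close> of the smallest members of the chain around its
  unmarked elements: the last element of \<open>D - W\<close> would be a marked position just above \<open>W\<close>.\<close>
lemma final_lower_set_in_chain:
  assumes V: "valid k d L C Q" and L: "finite L" "L \<subseteq> {..k}"
    and D: "D \<subseteq> L \<union> {k<..d}" "final k d D"
    and lower: "\<And>a b. (a, b) \<in> chain_preposet (L \<union> {k<..d}) C Q \<Longrightarrow> b \<in> D \<Longrightarrow> a \<in> D"
  shows "D \<in> C"
proof -
  have fC: "finite C" using V L finite_valid by blast
  have C: "{} \<in> C" "L \<union> {k<..d} \<in> C" "\<And>U. U \<in> C \<Longrightarrow> U \<subseteq> L \<union> {k<..d}"
    "\<forall>U\<in>C. \<forall>V\<in>C. U \<subseteq> V \<or> V \<subseteq> U" "Q \<subseteq> {k<..<d}"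
    "\<And>U q. U \<in> C \<Longrightarrow> q \<in> Q \<Longrightarrow> Suc q \<in> U \<Longrightarrow> q \<in> U"
    using V by (auto simp: valid_def)
  define v where "v b = \<Inter>{U\<in>C. b \<in> U}" for b
  have v: "v b \<in> C" "b \<in> v b" if "b \<in> D" for b
  proof -
    have "v b \<in> {U\<in>C. b \<in> U}" unfolding v_def
      by (rule chain_Union_mem) (use fC C(2,4) D(1) that in auto)
    then show "v b \<in> C" "b \<in> v b" by auto
  qed
  have vD: "v b \<subseteq> D" if "b \<in> D - Q" for b
  proof
    fix a assume "a \<in> v b"
    then have "(a, b) \<in> chain_preposet (L \<union> {k<..d}) C Q"
      using that v(1)[of b] C(3)[of "v b"] D(1) by (auto simp: chain_preposet_def v_def)
    then show "a \<in> D" using lower that by auto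
  qed
  \<comment> \<open>The extra \<open>{}\<close> covers a \<open>D\<close> without unmarked
    elements.\<close>
  define W where "W = \<Union>(insert {} (v ` (D - Q)))"
  have WC: "W \<in> C"
  proof -
    have "finite D" using D(1) L by (auto intro: finite_subset)
    then have "W \<in> insert {} (v ` (D - Q))" unfolding W_def
      by (intro chain_Union_mem) (use v C(4) in auto)
    then show ?thesis using v C(1) by auto
  qed
  have "W \<subseteq> D" using vD by (auto simp: W_def)
  moreover have "D \<subseteq> W"
  proof (rule ccontr)
    assume "\<not> D \<subseteq> W"
    then have ne: "D - W \<noteq> {}" by auto
    have fin: "finite (D - W)" using D(1) L by (auto intro: finite_subset)
    define q where "q = Max (D - W)"
    have q: "q \<in> D" "q \<notin> W" using Max_in[OF fin ne] by (auto simp: q_def)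
    have qmax: "q' \<le> q" if "q' \<in> D - W" for q' using fin that by (auto simp: q_def)
    have qQ: "q \<in> Q" using q v(2)[of q] by (auto simp: W_def)
    then have od: "k < q" "q < d" using C(5) by auto
    then have "Suc q \<in> D" using D(2) q by (auto simp: final_def)
    then have "Suc q \<in> W" using qmax[of "Suc q"] by auto
    then show False using C(6) WC qQ q by blast
  qed
  ultimately show ?thesis using WC by auto
qed

text \<open>Members of a chain are lower sets of its preposet, and remain so for a smaller preposet,
  where \<open>final_lower_set_in_chain\<close> identifies them. Marking is detected by the pair
  \<open>(Suc q, q)\<close>: by finality it belongs to the preposet when \<open>q\<close> is
  unmarked, and it does not when \<open>q\<close> is marked.\<close>

lemma chain_preposet_subset_iff:
  assumes V: "valid k d L C Q" "valid k d L C' Q'" and L: "finite L" "L \<subseteq> {..k}"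
  shows "chain_preposet (L \<union> {k<..d}) C Q \<subseteq> chain_preposet (L \<union> {k<..d}) C' Q' \<longleftrightarrow>
    C' \<subseteq> C \<and> Q' \<subseteq> Q"
proof
  assume sub: "chain_preposet (L \<union> {k<..d}) C Q \<subseteq> chain_preposet (L \<union> {k<..d}) C' Q'"
  have "U \<in> C" if "U \<in> C'" for U
  proof (rule final_lower_set_in_chain[OF V(1) L])
    show "U \<subseteq> L \<union> {k<..d}" "final k d U" using V(2) that by (auto simp: valid_def)
    fix a b assume "(a, b) \<in> chain_preposet (L \<union> {k<..d}) C Q" "b \<in> U"
    then show "a \<in> U" using sub that by (auto simp: chain_preposet_def)
  qed
  moreover have "q \<in> Q" if "q \<in> Q'" for q
  proof (rule ccontr)
    assume "q \<notin> Q"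
    have q: "k < q" "q < d" using V(2) that by (auto simp: valid_def)
    have "(Suc q, q) \<in> chain_preposet (L \<union> {k<..d}) C Q"
      using q \<open>q \<notin> Q\<close> V(1) by (auto simp: chain_preposet_def valid_def final_def)
    then show False using sub that by (auto simp: chain_preposet_def)
  qed
  ultimately show "C' \<subseteq> C \<and> Q' \<subseteq> Q" by blast
qed (auto simp: chain_preposet_def)

section \<open>Indexed nodes and blocks of a shade versus recursion on its levels\<close>

lemma index_Cons [simp]:
  "preceding_sum k ((s, c) # S) (Suc i) j = preceding_sum (k + sum_list s) S i j"
  "tuple_range k ((s, c) # S) (Suc i) = tuple_range (k + sum_list s) S i"
  "main_node k ((s, c) # S) (Suc i) = main_node (k + sum_list s) S i"
  "missing k ((s, c) # S) (Suc i) = missing (k + sum_list s) S i"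
  by (simp_all add: preceding_sum_def tuple_range_def main_node_def missing_def add.assoc)

lemma partial_sums_conv: "partial_sums k s = {k + sum_list (take (Suc j) s) | j. j < length s}"
proof (induction k s rule: partial_sums.induct)
  case (2 k x s)
  have "{k + sum_list (take (Suc j) (x # s)) | j. j < length (x # s)} =
    insert (k + x) {k + x + sum_list (take (Suc j) s) | j. j < length s}"
    by (auto simp: less_Suc_eq_0_disj add.assoc) (use not0_implies_Suc in force)
  then show ?case using 2 by simp
qed simp

lemma index_0 [simp]:
  "tuple_range k ((s, c) # S) 0 = {k<..k + sum_list s}"
  "main_node k ((s, c) # S) 0 = c \<union> partial_sums k s"
  by (auto simp: tuple_range_def main_node_def preceding_sum_def partial_sums_conv)

definition block :: "nat \<Rightarrow> shade \<Rightarrow> nat \<Rightarrow> nat set"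
  where "block k S i = labels_at S i \<union> tuple_range k S i"

lemma block_simps [simp]:
  "block k ((s, c) # S) 0 = c \<union> {k<..k + sum_list s}"
  "block k ((s, c) # S) (Suc i) = block (k + sum_list s) S i"
  by (simp_all add: block_def)

lemma UN_less_Suc: "(\<Union>i<Suc n. f i) = f 0 \<union> (\<Union>i<n. f (Suc i))"
  by (simp add: lessThan_Suc_eq_insert_0 image_image)

lemma ground_blocks: "ground k S = (\<Union>j<length S. block k S j)"
proof (induction k S rule: chain.induct)
  case (2 k s c S)
  then show ?case by (simp only: ground_Cons UN_less_Suc length_Cons block_simps)
qed simp

lemma ground_drop:
  "ground (k + entry_sum (take i S)) (drop i S) = (\<Union>j\<in>{i..<length S}. block k S j)"
proof (induction i arbitrary: k S)
  case 0
  then show ?case by (simp add: ground_blocks lessThan_atLeast0)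
next
  case (Suc i)
  show ?case
  proof (cases S)
    case (Cons a S')
    obtain s c where a: "a = (s, c)" by force
    show ?thesis using Suc[of "k + sum_list s" S'] Cons a
      by (simp add: add.assoc image_Suc_atLeastLessThan[symmetric] image_image del: image_Suc_atLeastLessThan)
  qed simp
qed

lemma Collect_le_Suc: "{f i | i. i \<le> Suc n} = insert (f 0) {f (Suc i) | i. i \<le> n}"
proof -
  have "{f i | i. i \<le> Suc n} = f ` {..Suc n}" "{f (Suc i) | i. i \<le> n} = (\<lambda>i. f (Suc i)) ` {..n}"
    by auto
  then show ?thesis by (simp add: atMost_Suc_eq_insert_0 image_image)
qed

lemma chain_index:
  "chain k S = {ground (k + entry_sum (take i S)) (drop i S) | i. i \<le> length S}"
proof (induction k S rule: chain.induct)
  case (2 k s c S)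
  let ?h = "\<lambda>i. ground (k + entry_sum (take i ((s, c) # S))) (drop i ((s, c) # S))"
  have "{?h i | i. i \<le> length ((s, c) # S)} = insert (?h 0) {?h (Suc i) | i. i \<le> length S}"
    unfolding length_Cons by (rule Collect_le_Suc)
  then show ?case using 2 by (simp add: add.assoc)
qed simp

text \<open>Required for composing relations along a path of nodes: through an empty node the
  composition would carry no information.\<close>

lemma main_node_nonempty:
  assumes "wf_shade L S" "i < length S"
  shows "main_node k S i \<noteq> {}"
  using assms
proof (induction k S arbitrary: L i rule: chain.induct)
  case (2 k s c S)
  show ?case
  proof (cases i)
    case 0
    then show ?thesis using 2(2) sum_list_in_partial_sums[of s k] by (cases "s = []") auto
  next
    case (Suc i')
    then show ?thesis using 2(1)[of "L - c" i'] 2(2,3) by auto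
  qed
qed simp

lemma main_node_subset_block:
  assumes "wf_shade L S" "i < length S"
  shows "main_node k S i \<subseteq> block k S i"
  using assms
proof (induction k S arbitrary: L i rule: chain.induct)
  case (2 k s c S)
  show ?case
  proof (cases i)
    case 0
    then show ?thesis using 2(2) partial_sums_subset[of s k] by auto
  next
    case (Suc i')
    then show ?thesis using 2(1)[of "L - c" i'] 2(2,3) by auto
  qed
qed simp

lemma block_split:
  assumes "wf_shade L S" "i < length S"
  shows "block k S i = main_node k S i \<union> missing k S i"
  using main_node_subset_block[OF assms, of k] by (auto simp: block_def missing_def main_node_def)

lemma block_disjoint:
  assumes "wf_shade L S" "L \<subseteq> {..k}" "i < length S" "j < length S" "i \<noteq> j"
  shows "block k S i \<inter> block k S j = {}"
proof -
  have "block k S i \<inter> block k S j = {}" if "i < j" "j < length S" "wf_shade L S" "L \<subseteq> {..k}" for i j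
    using that
  proof (induction k S arbitrary: L i j rule: chain.induct)
    case (2 k s c S)
    obtain j' where j: "j = Suc j'" using 2 by (cases j) auto
    show ?case
    proof (cases i)
      case 0
      have "block (k + sum_list s) S j' \<subseteq> ground (k + sum_list s) S"
        using 2(3) j by (auto simp: ground_blocks)
      also have "\<dots> \<subseteq> (L - c) \<union> {k + sum_list s<..}"
        using ground_eq[of "L - c" S] 2(4) by auto
      finally have "block (k + sum_list s) S j' \<inter> (c \<union> {k<..k + sum_list s}) = {}"
        using 2(4,5) by fastforce
      then show ?thesis using 0 j by auto
    next
      case (Suc i')
      then show ?thesis using 2(1)[of i' j' "L - c"] 2(2-5) j by fastforce
    qed
  qed simp
  then show ?thesis using assms by (metis Int_commute linorder_neqE_nat)
qed

lemma marked_index: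
  assumes "wf_shade L S" "L \<subseteq> {..k}"
  shows "marked k S = (\<Union>i<length S. missing k S i)"
  using assms
proof (induction k S arbitrary: L rule: chain.induct)
  case (2 k s c S)
  have "c \<inter> {k<..k + sum_list s} = {}" using 2(2,3) by fastforce
  then have "missing k ((s, c) # S) 0 = {k<..k + sum_list s} - partial_sums k s"
    by (auto simp: missing_def)
  moreover have "marked (k + sum_list s) S = (\<Union>i<length S. missing (k + sum_list s) S i)"
    using 2 by fastforce
  ultimately show ?case by (simp only: marked.simps UN_less_Suc length_Cons index_Cons)
qed simp

text \<open>Both sides compare levels: an element of block \<open>j\<close> lies below an element of
  the main node \<open>i\<close> iff \<open>i \<le> j\<close>. One direction follows paths arc by
  arc, the other climbs from main node to main node, after one initial arc if the element is
  marked.\<close>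

lemma preposet_eq:
  assumes wf: "wf_shade L S" and L: "L \<subseteq> {..k}"
  shows "preposet k S = chain_preposet (ground k S) (chain k S) (marked k S)"
proof -
  let ?l = "length S" and ?N = "main_node k S" and ?M = "missing k S" and ?B = "block k S"
  define U where "U i = (\<Union>j\<in>{i..<?l}. ?B j)" for i
  have ch: "chain k S = {U i | i. i \<le> ?l}" unfolding chain_index ground_drop U_def ..
  have Q: "marked k S = (\<Union>i<?l. ?M i)" by (rule marked_index[OF wf L])
  have X: "ground k S = (\<Union>i<?l. ?B i)" by (rule ground_blocks)
  have B: "?B i = ?N i \<union> ?M i" if "i < ?l" for i using block_split[OF wf that] .
  have NM: "?N i \<inter> ?M i = {}" for i by (auto simp: missing_def)
  have ne: "?N i \<noteq> {}" if "i < ?l" for i by (rule main_node_nonempty[OF wf that])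
  have dis: "i = j" if "a \<in> ?B i" "a \<in> ?B j" "i < ?l" "j < ?l" for a i j
    using block_disjoint[OF wf L that(3,4)] that by blast
  have memU: "a \<in> U i \<longleftrightarrow> i \<le> j" if "a \<in> ?B j" "j < ?l" for a i j
  proof
    assume "a \<in> U i"
    then obtain j' where "i \<le> j'" "j' < ?l" "a \<in> ?B j'" by (auto simp: U_def)
    then show "i \<le> j" using dis[of a j j'] that by simp
  qed (use that in \<open>auto simp: U_def\<close>)
  define R where "R a b \<longleftrightarrow> b \<notin> marked k S \<and> (\<forall>V\<in>chain k S. b \<in> V \<longrightarrow> a \<in> V)" for a b
  have R_trans: "R a c" if "R a b" "R b c" for a b c
    using that by (auto simp: R_def)
  have R1: "R a b" if "a \<in> ?B j" "b \<in> ?N i" "i \<le> j" "j < ?l" for a b i j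
    unfolding R_def
  proof
    have bB: "b \<in> ?B i" using B[of i] that by auto
    show "b \<notin> marked k S"
    proof
      assume "b \<in> marked k S"
      then obtain i' where "i' < ?l" "b \<in> ?M i'" using Q by auto
      then show False using dis[OF bB, of i'] B[of i'] NM[of i] that by auto
    qed
    show "\<forall>V\<in>chain k S. b \<in> V \<longrightarrow> a \<in> V"
      using memU[OF bB] memU[OF that(1,4)] that ch by auto
  qed
  have arcR: "\<forall>a\<in>X. \<forall>b\<in>Y. R a b" if "(X, Y) \<in> arcs k S" for X Y
    using that unfolding arcs_def
  proof
    assume "(X, Y) \<in> {({j}, ?N i) | i j. i < ?l \<and> j \<in> ?M i}"
    then obtain i j where "i < ?l" "j \<in> ?M i" "X = {j}" "Y = ?N i" by auto
    moreover from this have "j \<in> ?B i" using B by blast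
    ultimately show ?thesis using R1[of j i _ i] by simp
  next
    assume "(X, Y) \<in> {(?N (Suc i), ?N i) | i. Suc i < ?l}"
    then obtain i where "Suc i < ?l" "X = ?N (Suc i)" "Y = ?N i" by auto
    moreover from this have "?N (Suc i) \<subseteq> ?B (Suc i)" using B by blast
    ultimately show ?thesis using R1[of _ "Suc i" _ i] by (meson le_Suc_eq order_refl subsetD)
  qed
  have arc_ne: "Y \<noteq> {}" if "(X, Y) \<in> arcs k S" for X Y
  proof -
    have "\<exists>i<?l. Y = ?N i" using that unfolding arcs_def by (auto intro: Suc_lessD)
    then show ?thesis using ne by blast
  qed
  have pathR: "X = Y \<or> (\<forall>a\<in>X. \<forall>b\<in>Y. R a b)" if "(X, Y) \<in> (arcs k S)\<^sup>*" for X Y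
    using that
  proof (induction rule: rtrancl_induct)
    case (step Y Z)
    show ?case
    proof (cases "X = Y")
      case False
      then have XY: "\<forall>a\<in>X. \<forall>b\<in>Y. R a b" using step by auto
      \<comment> \<open>Every arc ends in a main node, so the intermediate node has an element
        through which transitivity of \<open>R\<close> applies.\<close>
      have "X \<noteq> Y" "Y \<noteq> {}" using False step(1) arc_ne by (auto elim: rtranclE)
      then obtain y where "y \<in> Y" by auto
      then show ?thesis using XY arcR[OF step(2)] R_trans by blast
    qed (use arcR[OF step(2)] in blast)
  qed simp
  have path: "(?N j, ?N i) \<in> (arcs k S)\<^sup>*" if "i \<le> j" "j < ?l" for i j
    using that
  proof (induction j rule: dec_induct)
    case (step j)
    then have "(?N (Suc j), ?N j) \<in> arcs k S" by (auto simp: arcs_def)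
    then show ?case using step by (simp add: converse_rtrancl_into_rtrancl)
  qed simp
  show ?thesis
  proof (intro subset_antisym subsetI)
    fix p assume "p \<in> preposet k S"
    then obtain a b V W where p: "p = (a, b)" "V \<in> nodes k S" "W \<in> nodes k S" "a \<in> V" "b \<in> W"
      "(V, W) \<in> (arcs k S)\<^sup>*" unfolding preposet_def by auto
    have inX: "V \<subseteq> ground k S" if "V \<in> nodes k S" for V
      using that B unfolding nodes_def X by auto
    have "a = b \<or> R a b"
    proof (cases "V = W")
      case True
      from p(2) consider i where "i < ?l" "V = ?N i" | j where "V = {j}" unfolding nodes_def by auto
      then show ?thesis
      proof cases
        case 1
        then have "a \<in> ?B i" "b \<in> ?N i" using B[of i] p True by auto
        then show ?thesis using R1[of a i b i] 1 by simp
      qed (use p True in auto)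
    qed (use pathR p in blast)
    then show "p \<in> chain_preposet (ground k S) (chain k S) (marked k S)"
      using p inX unfolding chain_preposet_def R_def by auto
  next
    fix p assume "p \<in> chain_preposet (ground k S) (chain k S) (marked k S)"
    then obtain a b where p: "p = (a, b)" "a \<in> ground k S" "b \<in> ground k S" "a = b \<or> R a b"
      unfolding chain_preposet_def R_def by auto
    obtain i j where ij: "i < ?l" "b \<in> ?B i" "j < ?l" "a \<in> ?B j" using p X by auto
    have nodeN: "?N i \<in> nodes k S" if "i < ?l" for i using that by (auto simp: nodes_def)
    have nodeM: "{x} \<in> nodes k S" if "i < ?l" "x \<in> ?M i" for i x using that by (auto simp: nodes_def)
    have "\<exists>V\<in>nodes k S. \<exists>W\<in>nodes k S. a \<in> V \<and> b \<in> W \<and> (V, W) \<in> (arcs k S)\<^sup>*"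
    proof (cases "a = b")
      case True
      have "\<exists>V\<in>nodes k S. a \<in> V" using B[OF ij(3)] ij nodeN nodeM by blast
      then show ?thesis using True by blast
    next
      case False
      then have R: "R a b" using p by auto
      then have bN: "b \<in> ?N i" using ij B Q by (auto simp: R_def)
      have "U i \<in> chain k S" using ch ij by auto
      then have "i \<le> j" using R memU[OF ij(2,1)] memU[OF ij(4,3)] by (auto simp: R_def)
      then have P: "(?N j, ?N i) \<in> (arcs k S)\<^sup>*" using path ij by auto
      show ?thesis
      proof (cases "a \<in> ?N j")
        case True
        then show ?thesis using P bN nodeN ij by blast
      next
        case False
        then have aM: "a \<in> ?M j" using B ij by auto
        then have "({a}, ?N j) \<in> arcs k S" using ij by (auto simp: arcs_def)
        then have "({a}, ?N i) \<in> (arcs k S)\<^sup>*" using P by (rule converse_rtrancl_into_rtrancl)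
        then show ?thesis using nodeM[OF ij(3) aM] nodeN[OF ij(1)] bN by blast
      qed
    qed
    then show "p \<in> preposet k S" unfolding preposet_def p(1) by auto
  qed
qed

section \<open>A relative interior point of each face\<close>

definition triangular :: "nat \<Rightarrow> real"
  where "triangular n = real ((n + 1) choose 2)"

lemma choose_two_real: "real (n choose 2) = real n * (real n - 1) / 2"
proof (cases n)
  case (Suc j)
  have "even (Suc j * j)" by simp
  then have "real (Suc j * j div 2) = real (Suc j * j) / 2" by (simp add: real_of_nat_div)
  then show ?thesis using Suc by (simp add: choose_two algebra_simps)
qed simp

lemma triangular_eq: "triangular n = real n * (real n + 1) / 2"
  by (simp add: triangular_def choose_two_real)

lemma triangular_0 [simp]: "triangular 0 = 0" and triangular_1 [simp]: "triangular (Suc 0) = 1"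
  by (simp_all add: triangular_eq)

definition missing_in :: "nat \<Rightarrow> nat list \<Rightarrow> nat set"
  where "missing_in k s = {k<..k + sum_list s} - partial_sums k s"

text \<open>Every element of a block gets the average \<open>v\<close> of the block, except that each marked position
  hands over \<open>v - 1\<close> to the last position of the block.\<close>
definition block_weight :: "nat \<Rightarrow> nat list \<Rightarrow> real \<Rightarrow> nat \<Rightarrow> real"
  where "block_weight k s v a =
    (if a \<in> missing_in k s then 1
     else if a = k + sum_list s then v + real (card (missing_in k s)) * (v - 1) else v)"

text \<open>With \<open>b\<close> elements in the later blocks and \<open>t\<close> in this one,
  this is \<open>(triangular (b + t) - triangular b) / t\<close>: the block raises a tight sum to
  the next tight sum.\<close>

definition block_average :: "nat \<Rightarrow> nat list \<Rightarrow> nat set \<Rightarrow> shade \<Rightarrow> real"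
  where "block_average k s c S =
    real (card (ground (k + sum_list s) S)) + (real (card c + sum_list s) + 1) / 2"

fun weight :: "nat \<Rightarrow> shade \<Rightarrow> nat \<Rightarrow> real"
  where
    "weight k [] a = 0"
  | "weight k ((s, c) # S) a =
      (if a \<in> c \<union> {k<..k + sum_list s} then block_weight k s (block_average k s c S) a
       else weight (k + sum_list s) S a)"

lemma finite_missing_in [simp]: "finite (missing_in k s)"
  by (simp add: missing_in_def)

lemma last_not_missing: "k + sum_list s \<notin> missing_in k s"
  by (cases "s = []") (auto simp: missing_in_def sum_list_in_partial_sums)

lemma sum_block_weight:
  assumes "finite D"
  shows "sum (block_weight k s v) D =
    real (card D) * v - real (card (D \<inter> missing_in k s)) * (v - 1) +
    (if k + sum_list s \<in> D then real (card (missing_in k s)) * (v - 1) else 0)"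
proof -
  let ?M = "missing_in k s" and ?e = "k + sum_list s"
  have "block_weight k s v a = v - (if a \<in> ?M then v - 1 else 0) +
      (if a = ?e then real (card ?M) * (v - 1) else 0)" for a
    using last_not_missing[of k s] by (auto simp: block_weight_def)
  then have "sum (block_weight k s v) D =
      (\<Sum>a\<in>D. v) - (\<Sum>a\<in>D. if a \<in> ?M then v - 1 else 0) +
      (\<Sum>a\<in>D. if a = ?e then real (card ?M) * (v - 1) else 0)"
    by (simp add: sum.distrib sum_subtractf)
  moreover have "(\<Sum>a\<in>D. if a \<in> ?M then v - 1 else 0) = real (card (D \<inter> ?M)) * (v - 1)"
    using sum.inter_restrict[OF assms, of "\<lambda>_. v - 1" ?M] by simp
  ultimately show ?thesis using assms by simp
qed

text \<open>The last position makes up for all marked positions of the block, hence at least for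
  those in \<open>D\<close>.\<close>

lemma sum_block_weight_ge:
  assumes "finite D" "1 \<le> v" "D \<inter> missing_in k s \<noteq> {} \<Longrightarrow> k + sum_list s \<in> D"
  shows "real (card D) * v \<le> sum (block_weight k s v) D"
proof (cases "D \<inter> missing_in k s = {}")
  case False
  have "real (card (D \<inter> missing_in k s)) * (v - 1) \<le> real (card (missing_in k s)) * (v - 1)"
    using assms(2) by (intro mult_right_mono) (auto intro: card_mono)
  then show ?thesis using assms False by (simp add: sum_block_weight)
qed (use assms in \<open>simp add: sum_block_weight\<close>)

lemma sum_block_weight_eq:
  assumes "finite D" "missing_in k s \<subseteq> D" "missing_in k s \<noteq> {} \<Longrightarrow> k + sum_list s \<in> D"
  shows "sum (block_weight k s v) D = real (card D) * v"
  using assms by (cases "missing_in k s = {}") (auto simp: sum_block_weight Int_absorb1)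

lemma finite_ground: "wf_shade L S \<Longrightarrow> finite L \<Longrightarrow> finite (ground k S)"
  by (simp add: ground_eq)

lemma block_ground_disjoint:
  assumes "wf_shade L ((s, c) # S)" "L \<subseteq> {..k}"
  shows "(c \<union> {k<..k + sum_list s}) \<inter> ground (k + sum_list s) S = {}"
  using assms ground_eq[of "L - c" S "k + sum_list s"] by fastforce

lemma card_block:
  assumes "wf_shade L ((s, c) # S)" "L \<subseteq> {..k}"
  shows "card (c \<union> {k<..k + sum_list s}) = card c + sum_list s"
proof -
  have "c \<subseteq> {..k}" using assms by auto
  then have "finite c" "c \<inter> {k<..k + sum_list s} = {}" using finite_subset by fastforce+
  then show ?thesis by (simp add: card_Un_disjoint)
qed

lemma card_block_pos:
  assumes "wf_shade L ((s, c) # S)" "L \<subseteq> {..k}"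
  shows "1 \<le> card c + sum_list s"
proof -
  have "finite c" using assms finite_subset[of c "{..k}"] by auto
  then show ?thesis using assms by (cases s) (auto simp: Suc_le_eq card_gt_0_iff)
qed

text \<open>Here \<open>f\<close> of the \<open>t\<close> elements of a block and \<open>u\<close>
  of the \<open>b\<close> later elements are taken. The difference of the two sides is
  \<open>f ((b - u) + (t - f) / 2)\<close>, which vanishes only if the block is avoided or
  everything is taken.\<close>

lemma triangular_split:
  assumes "f \<le> t" "u \<le> b"
  shows "triangular (f + u) \<le> real f * (real b + (real t + 1) / 2) + triangular u"
    and "triangular (f + u) = real f * (real b + (real t + 1) / 2) + triangular u \<longleftrightarrow> f = 0 \<or> f = t \<and> u = b"
proof -
  have eq: "real f * (real b + (real t + 1) / 2) + triangular u - triangular (f + u) =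
    real f * ((real b - real u) + (real t - real f) / 2)"
    by (simp add: triangular_eq field_simps)
  have ge: "real b - real u \<ge> 0" "real t - real f \<ge> 0" using assms by auto
  then have "real f * ((real b - real u) + (real t - real f) / 2) \<ge> 0" by simp
  then show "triangular (f + u) \<le> real f * (real b + (real t + 1) / 2) + triangular u" using eq by linarith
  have "triangular (f + u) = real f * (real b + (real t + 1) / 2) + triangular u \<longleftrightarrow>
    real f * ((real b - real u) + (real t - real f) / 2) = 0" using eq by linarith
  also have "\<dots> \<longleftrightarrow> f = 0 \<or> (real b - real u) + (real t - real f) / 2 = 0" by auto
  also have "(real b - real u) + (real t - real f) / 2 = 0 \<longleftrightarrow> real f = real t \<and> real u = real b"
  proof
    assume "(real b - real u) + (real t - real f) / 2 = 0"
    moreover have "x = 0 \<and> y = 0" if "x + y / 2 = 0" "0 \<le> x" "0 \<le> y" for x y :: real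
      using that by auto
    ultimately have "real b - real u = 0 \<and> real t - real f = 0" using ge by blast
    then show "real f = real t \<and> real u = real b" by simp
  qed simp
  finally show "triangular (f + u) = real f * (real b + (real t + 1) / 2) + triangular u \<longleftrightarrow>
    f = 0 \<or> f = t \<and> u = b" by simp
qed

text \<open>Split \<open>U\<close> into its part \<open>D\<close> in the first block and its part
  \<open>V\<close> in the later ones. The weights on \<open>D\<close> sum to at least
  \<open>card D\<close> times the average, induction bounds the sum over \<open>V\<close>, and
  \<open>triangular_split\<close> compares with the bound for \<open>U\<close>. Equality throughout
  forces \<open>D\<close> to be empty or \<open>U\<close> to be the whole ground set.\<close>

lemma weight_sum:
  assumes "wf_shade L S" "L \<subseteq> {..k}" "U \<subseteq> ground k S" "final k (k + entry_sum S) U"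
  shows "triangular (card U) \<le> sum (weight k S) U"
    and "sum (weight k S) U = triangular (card U) \<longleftrightarrow> U \<in> chain k S"
proof -
  have "triangular (card U) \<le> sum (weight k S) U \<and>
    (sum (weight k S) U = triangular (card U) \<longleftrightarrow> U \<in> chain k S)"
    using assms
  proof (induction k S arbitrary: L U rule: chain.induct)
    case (2 k s c S)
    let ?e = "k + sum_list s" and ?d = "k + entry_sum ((s, c) # S)"
    let ?B = "c \<union> {k<..?e}" and ?G = "ground ?e S" and ?v = "block_average k s c S"
    note wf = 2(2) and L = 2(3)
    have wf': "wf_shade (L - c) S" "L - c \<subseteq> {..?e}" using wf L by auto
    have fL: "finite L" using L finite_subset by blast
    then have fG: "finite ?G" using finite_ground[OF wf'(1)] by auto
    have fB: "finite ?B" using fL wf by (auto intro: finite_subset)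
    have dis: "?B \<inter> ?G = {}" by (rule block_ground_disjoint[OF wf L])
    define D V where DV: "D = U \<inter> ?B" "V = U \<inter> ?G"
    have UDV: "U = D \<union> V" "D \<inter> V = {}" "finite D" "finite V"
      using 2(4) dis fB fG by (auto simp: DV ground_Cons)
    have finV: "final ?e (?e + entry_sum S) V"
      unfolding final_def
    proof (intro allI impI)
      fix p q assume pq: "?e < p" "p \<le> q" "q \<le> ?e + entry_sum S" "p \<in> V"
      then have "q \<in> U" using 2(5) unfolding final_def DV by (simp add: add.assoc) (metis le_add1 le_less_trans)
      then show "q \<in> V" using pq by (simp add: DV ground_def)
    qed
    have IH: "triangular (card V) \<le> sum (weight ?e S) V"
      "sum (weight ?e S) V = triangular (card V) \<longleftrightarrow> V \<in> chain ?e S"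
      using 2(1)[OF wf' _ finV] by (auto simp: DV)
    have "1 \<le> real (card c + sum_list s)" using card_block_pos[OF wf L] by linarith
    then have v1: "1 \<le> ?v" unfolding block_average_def by (simp add: field_simps)
    have sD: "sum (weight k ((s, c) # S)) D = sum (block_weight k s ?v) D"
      by (rule sum.cong) (auto simp: DV)
    have sV: "sum (weight k ((s, c) # S)) V = sum (weight ?e S) V"
      using dis by (intro sum.cong) (auto simp: DV)
    have sU: "sum (weight k ((s, c) # S)) U = sum (block_weight k s ?v) D + sum (weight ?e S) V"
      using UDV by (simp only: UDV(1) sum.union_disjoint sD sV)
    have cU: "card U = card D + card V" using UDV by (simp add: card_Un_disjoint)
    have cD: "card D \<le> card c + sum_list s"
      using card_mono[OF fB, of D] card_block[OF wf L] by (simp add: DV)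
    have cV: "card V \<le> card ?G" using card_mono[OF fG, of V] by (simp add: DV)
    have geD: "real (card D) * ?v \<le> sum (block_weight k s ?v) D"
    proof (rule sum_block_weight_ge[OF UDV(3) v1])
      assume "D \<inter> missing_in k s \<noteq> {}"
      then obtain p where "k < p" "p \<le> ?e" "p \<in> U" by (auto simp: missing_in_def DV)
      moreover from this have "?e \<in> U" using 2(5) unfolding final_def by fastforce
      ultimately show "?e \<in> D" by (auto simp: DV)
    qed
    have split: "triangular (card U) \<le> real (card D) * ?v + triangular (card V)"
      "triangular (card U) = real (card D) * ?v + triangular (card V) \<longleftrightarrow>
        card D = 0 \<or> card D = card c + sum_list s \<and> card V = card ?G"
      unfolding cU block_average_def using triangular_split[OF cD cV] by auto
    have "U \<in> chain k ((s, c) # S)" if eq: "sum (weight k ((s, c) # S)) U = triangular (card U)"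
    proof -
      have "triangular (card U) = real (card D) * ?v + triangular (card V)"
        and VC: "sum (weight ?e S) V = triangular (card V)"
        using eq sU geD IH(1) split(1) by linarith+
      then consider "D = {}" | "card D = card c + sum_list s" "card V = card ?G"
        using split(2) UDV(3) by auto
      then show ?thesis
      proof cases
        case 1
        then show ?thesis using IH(2) VC UDV by auto
      next
        case 2
        then have "D = ?B" using card_subset_eq[OF fB, of D] card_block[OF wf L] by (auto simp: DV)
        moreover have "V = ?G" using 2 card_subset_eq[OF fG, of V] by (auto simp: DV)
        ultimately show ?thesis using UDV(1) by (auto simp: ground_Cons)
      qed
    qed
    moreover have "sum (weight k ((s, c) # S)) U = triangular (card U)" if "U \<in> chain k ((s, c) # S)"
    proof -
      have "U = ground k ((s, c) # S) \<or> U \<in> chain ?e S" using that by simp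
      then show ?thesis
      proof
        assume "U \<in> chain ?e S"
        moreover from this have "U \<subseteq> ?G" by (rule chain_subset)
        then have "D = {}" "V = U" using dis by (auto simp: DV)
        ultimately show ?thesis using IH(2) sU by simp
      next
        assume "U = ground k ((s, c) # S)"
        then have "D = ?B" "V = ?G" by (auto simp: DV ground_Cons)
        moreover have "sum (block_weight k s ?v) ?B = real (card ?B) * ?v"
          by (rule sum_block_weight_eq[OF fB]) (auto simp: missing_in_def)
        ultimately show ?thesis
          using sU IH(2) split(2) chain_ground[of ?e S] card_block[OF wf L] by simp
      qed
    qed
    ultimately show ?case using sU geD IH(1) split(1) by force
  qed (simp add: triangular_def)
  then show "triangular (card U) \<le> sum (weight k S) U"
    "sum (weight k S) U = triangular (card U) \<longleftrightarrow> U \<in> chain k S" by auto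
qed

lemma weight_outside: "a \<notin> ground k S \<Longrightarrow> weight k S a = 0"
  by (induction k S a rule: weight.induct) (auto simp: ground_Cons)

text \<open>A block average equals 1 only for a single element with nothing after it. Since
  \<open>q\<close> is not the last position overall, the average of its block exceeds 1, and so does
  every weight in it that is not lowered.\<close>

lemma weight_marked:
  assumes "wf_shade L S" "L \<subseteq> {..k}" "k < q" "q < k + entry_sum S"
  shows "1 \<le> weight k S q \<and> (weight k S q = 1 \<longleftrightarrow> q \<in> marked k S)"
  using assms
proof (induction k S arbitrary: L rule: chain.induct)
  case (2 k s c S)
  let ?e = "k + sum_list s" and ?v = "block_average k s c S"
  note wf = 2(2) and L = 2(3)
  have wf': "wf_shade (L - c) S" "L - c \<subseteq> {..?e}" using wf L by auto
  have marked': "marked ?e S \<subseteq> {?e<..}" using valid_shade[OF wf'] by (fastforce simp: valid_def)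
  have c: "q \<notin> c" using wf L 2(4) by auto
  show ?case
  proof (cases "q \<le> ?e")
    case True
    have "card (ground ?e S) \<ge> entry_sum S"
      using card_mono[OF finite_ground[OF wf'(1), of ?e], of "{?e<..?e + entry_sum S}"] finite_subset[OF L]
      by (auto simp: ground_def)
    \<comment> \<open>Position \<open>q + 1\<close> exists: it is in the same tuple or in a later
      one.\<close>
    moreover have "sum_list s \<ge> 2 \<or> entry_sum S \<ge> 1" using 2(4,5) True by auto
    ultimately have "1 \<le> card (ground ?e S) \<or> 2 \<le> card c + sum_list s" by linarith
    then have "1 \<le> real (card (ground ?e S)) \<or> 2 \<le> real (card c + sum_list s)" by linarith
    moreover have "1 \<le> real (card c + sum_list s)" using card_block_pos[OF wf L] by linarith
    ultimately have v: "1 < ?v" unfolding block_average_def by (auto simp: field_simps)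
    have "weight k ((s, c) # S) q = block_weight k s ?v q" using 2(4) True by simp
    moreover have nn: "0 \<le> real (card (missing_in k s)) * (?v - 1)" using v by simp
    have "1 < block_weight k s ?v q" if "q \<notin> missing_in k s"
      unfolding block_weight_def using add_less_le_mono[OF v nn] v that by simp
    moreover have "block_weight k s ?v q = 1" if "q \<in> missing_in k s"
      using that by (simp add: block_weight_def)
    ultimately have "1 \<le> weight k ((s, c) # S) q \<and>
        (weight k ((s, c) # S) q = 1 \<longleftrightarrow> q \<in> missing_in k s)"
      by (cases "q \<in> missing_in k s") auto
    moreover have "q \<in> missing_in k s \<longleftrightarrow> q \<in> marked k ((s, c) # S)"
      using marked' True by (auto simp: missing_in_def)
    ultimately show ?thesis by simp
  next
    case False
    then show ?thesis using 2(1)[OF wf'] 2(5) c by auto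
  qed
qed simp

section \<open>Unary shades\<close>

text \<open>In a well-formed shade \<open>card c + length s\<close> is the size of the main node, so
  all main nodes are singletons.\<close>

definition unary :: "shade \<Rightarrow> bool"
  where "unary S \<longleftrightarrow> (\<forall>(s, c)\<in>set S. card c + length s = 1)"

lemma unary_simps [simp]:
  "unary []" "unary ((s, c) # S) \<longleftrightarrow> card c + length s = 1 \<and> unary S"
  by (simp_all add: unary_def)

lemma wf_shade_ConsD:
  assumes "wf_shade L ((s, c) # S)" "L \<subseteq> {..k}"
  shows "wf_shade (L - c) S" "L - c \<subseteq> {..k + sum_list s}" "\<forall>x\<in>set s. 0 < x"
    "c \<subseteq> {..k}" "finite c" "finite L"
proof -
  show "wf_shade (L - c) S" "L - c \<subseteq> {..k + sum_list s}" "\<forall>x\<in>set s. 0 < x"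
    using assms by auto
  show "c \<subseteq> {..k}" using assms by auto
  then show "finite c" by (rule finite_subset) simp
  show "finite L" using assms(2) by (rule finite_subset) simp
qed

text \<open>The rank is the sum of \<open>card c + length s - 1\<close> over the levels, and no
  level contributes a negative amount.\<close>

lemma rank_sum:
  assumes "wf_shade L S" "finite L"
  shows "0 \<le> int (card L) - int (length S) + (\<Sum>(s, c) \<leftarrow> S. int (length s))"
    and "int (card L) - int (length S) + (\<Sum>(s, c) \<leftarrow> S. int (length s)) = 0 \<longleftrightarrow> unary S"
proof -
  let ?r = "\<lambda>L S. int (card L) - int (length S) + (\<Sum>(s, c) \<leftarrow> S. int (length s))"
  have "0 \<le> ?r L S \<and> (?r L S = 0 \<longleftrightarrow> unary S)"
    using assms
  proof (induction L S rule: wf_shade.induct)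
    case (2 L s c S)
    have c: "c \<subseteq> L" "finite c" "s = [] \<longrightarrow> c \<noteq> {}" using 2 finite_subset by auto
    have "card L = card c + card (L - c)"
      using c 2(3) by (simp add: card_Diff_subset card_mono)
    then have eq: "?r L ((s, c) # S) = int (card c + length s) - 1 + ?r (L - c) S" by simp
    have "1 \<le> card c + length s" using c by (cases s) (auto simp: Suc_le_eq card_gt_0_iff)
    moreover have "0 \<le> ?r (L - c) S \<and> (?r (L - c) S = 0 \<longleftrightarrow> unary S)" using 2 by auto
    ultimately show ?case unfolding eq unary_simps by linarith
  qed simp
  then show "0 \<le> ?r L S" "?r L S = 0 \<longleftrightarrow> unary S" by auto
qed

lemma unary_shades_iff: "S \<in> unary_shades m n \<longleftrightarrow> S \<in> shades m n \<and> unary S"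
  using rank_sum(2)[of "{1..m}" S] by (auto simp: unary_shades_def shade_rank_def shades_iff)

lemma card_partial_sums: "\<forall>x\<in>set s. 0 < x \<Longrightarrow> card (partial_sums k s) = length s"
proof (induction k s rule: partial_sums.induct)
  case (2 k x s)
  have "k + x \<notin> partial_sums (k + x) s" using partial_sums_subset[of s "k + x"] 2(2) by auto
  moreover have "finite (partial_sums (k + x) s)"
    using partial_sums_subset[of s "k + x"] 2(2) finite_subset by auto
  ultimately show ?case using 2 by simp
qed simp

text \<open>Two elements of the same main node give a direction of the face.\<close>
lemma not_unary_direction:
  assumes "wf_shade L S" "L \<subseteq> {..k}" "\<not> unary S"
  shows "\<exists>a b. a \<noteq> b \<and> a \<in> ground k S - marked k S \<and> b \<in> ground k S - marked k S \<and>
    (\<forall>U\<in>chain k S. a \<in> U \<longleftrightarrow> b \<in> U)"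
  using assms
proof (induction k S arbitrary: L rule: chain.induct)
  case (2 k s c S)
  let ?e = "k + sum_list s"
  note D = wf_shade_ConsD[OF 2(2,3)]
  note wf' = D(1,2) and pos = D(3) and c = D(4,5)
  note ps = partial_sums_subset[OF pos, of k]
  have dis: "(c \<union> {k<..?e}) \<inter> ground ?e S = {}" by (rule block_ground_disjoint[OF 2(2,3)])
  have marked': "marked ?e S \<subseteq> {?e<..}" using valid_shade[OF wf'] by (fastforce simp: valid_def)
  show ?case
  proof (cases "card c + length s = 1")
    case True
    then have "\<not> unary S" using 2(4) by simp
    then obtain a b where ab: "a \<noteq> b" "a \<in> ground ?e S - marked ?e S" "b \<in> ground ?e S - marked ?e S"
      "\<forall>U\<in>chain ?e S. a \<in> U \<longleftrightarrow> b \<in> U" using 2(1)[OF wf'] by auto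
    moreover have "a \<notin> {k<..?e}" "b \<notin> {k<..?e}" using ab dis by blast+
    ultimately have "a \<in> ground k ((s, c) # S) - marked k ((s, c) # S)"
      "b \<in> ground k ((s, c) # S) - marked k ((s, c) # S)"
      by (auto simp: ground_Cons)
    moreover have "\<forall>U\<in>chain k ((s, c) # S). a \<in> U \<longleftrightarrow> b \<in> U"
      using ab(2-4) unfolding chain.simps ground_Cons by blast
    ultimately show ?thesis using ab(1) by blast
  next
    case False
    let ?N = "c \<union> partial_sums k s"
    have "c \<inter> partial_sums k s = {}" using c ps by fastforce
    moreover have "finite (partial_sums k s)" using ps finite_subset by auto
    ultimately have cN: "card ?N = card c + length s" "finite ?N"
      using c pos by (auto simp: card_Un_disjoint card_partial_sums)
    have "1 \<le> card c + length s" using 2(2) c by (cases s) (auto simp: Suc_le_eq card_gt_0_iff)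
    then have "\<not> card ?N \<le> Suc 0" using False cN by simp
    then obtain a b where ab: "a \<in> ?N" "b \<in> ?N" "a \<noteq> b"
      using cN(2) by (auto simp: card_le_Suc0_iff_eq)
    have NB: "?N \<subseteq> c \<union> {k<..?e}" using ps by auto
    have unm: "x \<notin> marked k ((s, c) # S)" if "x \<in> ?N" for x
      using that NB c marked' by fastforce
    have out: "x \<notin> U" if "x \<in> ?N" "U \<in> chain ?e S" for x U
      using that NB dis chain_subset[OF that(2)] by blast
    have "x \<in> ground k ((s, c) # S)" if "x \<in> ?N" for x
      using that NB unfolding ground_Cons by blast
    note inG = this[OF ab(1)] this[OF ab(2)]
    have "\<forall>U\<in>chain k ((s, c) # S). a \<in> U \<longleftrightarrow> b \<in> U"
      unfolding chain.simps using inG out[OF ab(1)] out[OF ab(2)] by blast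
    moreover have "a \<in> ground k ((s, c) # S) - marked k ((s, c) # S)"
      "b \<in> ground k ((s, c) # S) - marked k ((s, c) # S)"
      using inG unm[OF ab(1)] unm[OF ab(2)] by blast+
    ultimately show ?thesis using ab(3) by blast
  qed
qed simp

text \<open>Meant for the difference of two points of one face. Working upwards from the last block,
  each block has sum 0 and vanishes at its marked positions; only one element is left in it, which
  must be 0 too.\<close>

lemma unary_unique:
  fixes z :: "nat \<Rightarrow> real"
  assumes "wf_shade L S" "L \<subseteq> {..k}" "unary S"
    and "\<And>U. U \<in> chain k S \<Longrightarrow> sum z U = 0" "\<And>q. q \<in> marked k S \<Longrightarrow> z q = 0"
  shows "\<forall>a\<in>ground k S. z a = 0"
  using assms
proof (induction k S arbitrary: L rule: chain.induct)
  case (2 k s c S)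
  let ?e = "k + sum_list s" and ?B = "c \<union> {k<..k + sum_list s}"
  note D = wf_shade_ConsD[OF 2(2,3)]
  note wf' = D(1,2) and pos = D(3) and c = D(4-6)
  note ps = partial_sums_subset[OF pos, of k]
  have rest: "\<forall>a\<in>ground ?e S. z a = 0" using 2(1)[OF wf'] 2(4-6) by simp
  have fB: "finite ?B" using c by auto
  have "sum z (?B \<union> ground ?e S) = 0" using 2(5)[of "ground k ((s, c) # S)"] by (simp add: ground_Cons)
  then have sB: "sum z ?B = 0"
    using sum.union_disjoint[OF fB finite_ground[OF wf'(1)] block_ground_disjoint[OF 2(2,3)], of z] c rest
    by simp
  let ?N = "c \<union> partial_sums k s"
  have "c \<inter> partial_sums k s = {}" using c ps by fastforce
  moreover have "finite (partial_sums k s)" using ps finite_subset by auto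
  ultimately have "card ?N = 1" using 2(4) c pos by (auto simp: card_Un_disjoint card_partial_sums)
  then obtain a where a: "?N = {a}" by (auto simp: card_1_singleton_iff)
  have zero: "z b = 0" if "b \<in> ?B" "b \<noteq> a" for b
  proof -
    have "b \<notin> ?N" using a that by auto
    then show ?thesis using that by (intro 2(6)) auto
  qed
  have "a \<in> ?B" using a ps by auto
  then have "sum z ?B = z a"
    using sum.mono_neutral_right[OF fB, of "{a}" z] zero by auto
  then have "\<forall>b\<in>?B. z b = 0" using zero sB by metis
  then show ?case using rest by (auto simp: ground_Cons)
qed simp

lemma finite_shades: "finite (shades m n)"
proof (rule finite_imageD)
  let ?X = "{1..m} \<union> {m<..m + n}"
  have "(\<lambda>S. (chain m S, marked m S)) ` shades m n \<subseteq> Pow (Pow ?X) \<times> Pow ?X"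
  proof clarify
    fix S assume "S \<in> shades m n"
    then have "valid m (m + n) {1..m} (chain m S) (marked m S)"
      using valid_shade[of "{1..m}" S m] by (auto simp: shades_iff)
    then show "chain m S \<in> Pow (Pow ?X) \<and> marked m S \<in> Pow ?X" by (auto simp: valid_def)
  qed
  then show "finite ((\<lambda>S. (chain m S, marked m S)) ` shades m n)" by (rule finite_subset) auto
  show "inj_on (\<lambda>S. (chain m S, marked m S)) (shades m n)"
    by (rule inj_onI) (auto simp: shades_iff intro: shade_inj[of "{1..m}" _ _ m])
qed

section \<open>The coordinates of the points of unary shades\<close>

lemma weight_index:
  assumes "wf_shade L S" "L \<subseteq> {..k}" "i < length S" "a \<in> block k S i"
  shows "weight k S a =
    block_weight (k + entry_sum (take i S)) (tuple_at S i)
      (block_average (k + entry_sum (take i S)) (tuple_at S i) (labels_at S i) (drop (Suc i) S)) a"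
  using assms
proof (induction k S arbitrary: L i rule: chain.induct)
  case (2 k s c S)
  show ?case
  proof (cases i)
    case 0
    then show ?thesis using 2(5) by simp
  next
    case (Suc j)
    have wf': "wf_shade (L - c) S" "L - c \<subseteq> {..k + sum_list s}" using 2(2,3) by auto
    have "a \<in> ground (k + sum_list s) S" using 2(4,5) Suc by (auto simp: ground_blocks)
    then have "a \<notin> c \<union> {k<..k + sum_list s}" using block_ground_disjoint[OF 2(2,3)] by blast
    then show ?thesis using 2(1)[OF wf', of j] 2(4,5) Suc by (auto simp: add.assoc)
  qed
qed simp

lemma cuts_from_eq: "cuts_from S i = length (filter (\<lambda>(s, c). c \<noteq> {}) (drop i S))"
proof -
  have "{j. i \<le> j \<and> j < length S \<and> labels_at S j \<noteq> {}} =
    (+) i ` {j. j < length (drop i S) \<and> (\<lambda>(s, c). c \<noteq> {}) (drop i S ! j)}"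
  proof (intro subset_antisym subsetI)
    fix j assume "j \<in> {j. i \<le> j \<and> j < length S \<and> labels_at S j \<noteq> {}}"
    then show "j \<in> (+) i ` {j. j < length (drop i S) \<and> (\<lambda>(s, c). c \<noteq> {}) (drop i S ! j)}"
      by (intro image_eqI[of _ _ "j - i"]) (auto simp: split_beta)
  qed (auto simp: split_beta)
  then show ?thesis
    by (simp add: cuts_from_def length_filter_conv_card card_image)
qed

lemma unary_cuts:
  assumes "wf_shade L S" "finite L" "unary S"
  shows "length (filter (\<lambda>(s, c). c \<noteq> {}) S) = card L"
  using assms
proof (induction L S rule: wf_shade.induct)
  case (2 L s c S)
  have c: "c \<subseteq> L" "finite c" using 2 finite_subset by auto
  have "card L = card c + card (L - c)" using c 2(3) by (simp add: card_Diff_subset card_mono)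
  moreover have "card c = (if c = {} then 0 else 1)"
  proof (cases "c = {}")
    case False
    then have "0 < card c" using c by (simp add: card_gt_0_iff)
    then show ?thesis using 2(4) False by auto
  qed simp
  moreover have "length (filter (\<lambda>(s, c). c \<noteq> {}) S) = card (L - c)" using 2 by auto
  moreover have "length (filter (\<lambda>(s, c). c \<noteq> {}) ((s, c) # S)) =
      (if c = {} then 0 else 1) + length (filter (\<lambda>(s, c). c \<noteq> {}) S)" by simp
  ultimately show ?case by linarith
qed simp

lemma wf_shade_drop:
  assumes "wf_shade L S" "L \<subseteq> {..k}"
  shows "\<exists>L'. L' \<subseteq> L \<and> wf_shade L' (drop i S)"
  using assms
proof (induction i arbitrary: L S)
  case (Suc i)
  show ?case
  proof (cases S)
    case (Cons a S')
    obtain s c where "a = (s, c)" by force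
    then have "wf_shade (L - c) S'" "L - c \<subseteq> {..k}" using Suc Cons by auto
    then obtain L' where "L' \<subseteq> L - c" "wf_shade L' (drop i S')" using Suc.IH by blast
    then show ?thesis using Cons by auto
  qed (use Suc in auto)
qed auto

text \<open>Each cut of a unary shade carries one label, so the cuts and entry sums in the
  definition of the points together count the elements of the remaining blocks.\<close>

lemma card_ground_drop:
  assumes "wf_shade L S" "L \<subseteq> {..m}" "unary S" "m \<le> k"
  shows "card (ground k (drop i S)) = cuts_from S i + entry_sum (drop i S)"
proof -
  obtain L' where L': "L' \<subseteq> L" "wf_shade L' (drop i S)" using wf_shade_drop assms by blast
  have fin: "finite L'" using L'(1) assms(2) finite_subset by (metis finite_atMost)
  have "unary (drop i S)" using assms(3) by (auto simp: unary_def dest: in_set_dropD)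
  then have "card L' = cuts_from S i" using unary_cuts[OF L'(2) fin] by (simp add: cuts_from_eq)
  moreover have "L' \<inter> {k<..k + entry_sum (drop i S)} = {}" using L'(1) assms by fastforce
  ultimately show ?thesis using fin by (simp add: ground_eq[OF L'(2)] card_Un_disjoint)
qed

lemma entry_sum_append: "entry_sum (S @ T) = entry_sum S + entry_sum T"
  by (simp add: entry_sum_def)

lemma cuts_from_Suc:
  assumes "i < length S"
  shows "cuts_from S i = cuts_from S (Suc i) + (if labels_at S i = {} then 0 else 1)"
  unfolding cuts_from_eq by (subst Cons_nth_drop_Suc[OF assms, symmetric]) (simp add: split_beta)

lemma unary_at:
  assumes "unary S" "wf_shade L S" "L \<subseteq> {..m}" "i < length S"
  obtains p where "S ! i = ([], {p})" | x where "S ! i = ([x], {})" "0 < x"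
proof -
  obtain s c where sc: "S ! i = (s, c)" by force
  then have mem: "(s, c) \<in> set S" using assms(4) by (metis nth_mem)
  then have "c \<subseteq> L" using wf_shade_labels[OF assms(2)] by (auto simp: all_labels_def)
  then have "finite c" using assms(3) finite_subset by (metis finite_atMost)
  moreover have "card c + length s = 1" using assms(1) mem by (auto simp: unary_def)
  moreover have "\<forall>x\<in>set s. 0 < x" using assms(2) mem by (auto simp: wf_shade_iff)
  ultimately show ?thesis using that sc
    by (cases s) (auto simp: card_1_singleton_iff add_is_1)
qed

text \<open>Let \<open>b\<close> count the elements in the later blocks. A cut is a block of size 1
  with average \<open>b + 1\<close>. For a single entry \<open>x\<close> the average is
  \<open>v = b + (x + 1) / 2\<close> and there are \<open>x - 1\<close> marked positions, so the
  last position has weight \<open>v + (x - 1) (v - 1) = 1 + x b + x (x - 1) / 2\<close>.\<close>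

lemma point_coord_eq_weight:
  assumes S: "S \<in> unary_shades m n" and p: "p \<in> {1..m + n}"
  shows "real (point_coord m n S p) = weight m S p"
proof -
  have wf: "wf_shade {1..m} S" and n: "entry_sum S = n" and un: "unary S"
    using S by (auto simp: unary_shades_iff shades_iff)
  have L: "{1..m} \<subseteq> {..m}" by auto
  have "p \<in> ground m S" using p n by (auto simp: ground_eq[OF wf])
  then obtain i where i: "i < length S" "p \<in> block m S i" by (auto simp: ground_blocks)
  have uniq: "j = i" if "j < length S" "p \<in> block m S j" for j
    using block_disjoint[OF wf L that(1) i(1)] that i by blast
  let ?k = "m + entry_sum (take i S)"
  have split: "entry_sum (take i S) + (sum_list (tuple_at S i) + entry_sum (drop (Suc i) S)) = n"
    using n i(1) by (metis Cons_nth_drop_Suc append_take_drop_id entry_sum_append entry_sum_simps(2)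
        prod.collapse)
  define b where "b = cuts_from S (Suc i) + entry_sum (drop (Suc i) S)"
  have b: "card (ground (?k + sum_list (tuple_at S i)) (drop (Suc i) S)) = b"
    unfolding b_def by (rule card_ground_drop[OF wf L un]) simp
  have range: "tuple_range m S i = {?k<..?k + sum_list (tuple_at S i)}"
    using i(1) by (auto simp: tuple_range_def take_Suc_conv_app_nth entry_sum_append entry_sum_def split_beta)
  have W: "weight m S p = block_weight ?k (tuple_at S i)
      (real b + (real (card (labels_at S i) + sum_list (tuple_at S i)) + 1) / 2) p"
    using weight_index[OF wf L i] b by (simp add: block_average_def)
  consider q where "S ! i = ([], {q})" | x where "S ! i = ([x], {})" "0 < x"
    using unary_at[OF un wf L i(1)] by metis
  then show ?thesis
  proof cases
    case 1
    then have q: "p = q" using i(2) range by (auto simp: block_def)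
    have "q \<in> {1..m}" using wf_shade_labels[OF wf] 1 i(1) by (force simp: all_labels_def dest: nth_mem)
    then have "p \<le> m" using q by simp
    moreover have "(THE j. j < length S \<and> p \<in> labels_at S j) = i"
    proof (rule the_equality)
      show "i < length S \<and> p \<in> labels_at S i" using 1 q i(1) by simp
      show "j = i" if "j < length S \<and> p \<in> labels_at S j" for j
        using uniq[of j] that by (simp add: block_def)
    qed
    ultimately have "point_coord m n S p = b + 1"
      using 1 cuts_from_Suc[OF i(1)] by (simp add: point_coord_def b_def)
    then show ?thesis using W 1 by (simp add: block_weight_def missing_in_def)
  next
    case 2
    have pr: "?k < p" "p \<le> ?k + x" using i(2) range 2 by (auto simp: block_def)
    have ps: "preceding_sum m S j 0 \<in> block m S j" if "j < length S" "tuple_at S j \<noteq> []" for j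
      using unary_at[OF un wf L that(1)]
    proof cases
      case (2 y)
      then show ?thesis using that
        by (auto simp: block_def preceding_sum_def tuple_range_def take_Suc_conv_app_nth
            entry_sum_append entry_sum_def)
    qed (use that in auto)
    have psi: "preceding_sum m S i 0 = ?k + x" using 2 by (simp add: preceding_sum_def)
    have uniq_ps: "j = i" if "j < length S" "tuple_at S j \<noteq> []" "p = preceding_sum m S j 0" for j
      using uniq[of j] ps[of j] that by simp
    show ?thesis
    proof (cases "p = ?k + x")
      case True
      have "(THE j. j < length S \<and> tuple_at S j \<noteq> [] \<and> p = preceding_sum m S j 0) = i"
      proof (rule the_equality)
        show "i < length S \<and> tuple_at S i \<noteq> [] \<and> p = preceding_sum m S i 0"
          using 2 psi True i(1) by simp
        show "j = i" if "j < length S \<and> tuple_at S j \<noteq> [] \<and> p = preceding_sum m S j 0" for j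
          using uniq_ps that by blast
      qed
      moreover have "\<exists>j < length S. tuple_at S j \<noteq> [] \<and> p = preceding_sum m S j 0"
        using 2 psi True i(1) by auto
      \<comment> \<open>As \<open>p\<close> ends its block, \<open>m + n - p\<close> is the sum of
        the entries below.\<close>
      moreover have "m + n - p + cuts_from S (Suc i) = b"
        using split True 2 by (simp add: b_def)
      ultimately have "point_coord m n S p = 1 + x * b + (x choose 2)"
        using pr 2 by (simp add: point_coord_def Let_def)
      moreover have "p \<notin> missing_in ?k [x]" using True by (simp add: missing_in_def)
      moreover have "missing_in ?k [x] = {?k<..<?k + x}" by (auto simp: missing_in_def)
      ultimately show ?thesis using W 2 True
        by (simp add: block_weight_def choose_two_real field_simps)
    next
      case False
      then have "\<not> (\<exists>j < length S. tuple_at S j \<noteq> [] \<and> p = preceding_sum m S j 0)"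
        using uniq_ps psi by metis
      then have "point_coord m n S p = 1" using pr by (auto simp: point_coord_def)
      moreover have "p \<in> missing_in ?k [x]" using False pr by (simp add: missing_in_def)
      ultimately show ?thesis using W 2 by (simp add: block_weight_def)
    qed
  qed
qed

section \<open>The Hochschild polytope\<close>

lemma lookup_scaleR_real [simp]:
  "Poly_Mapping.lookup (r *\<^sub>R x) i = r * Poly_Mapping.lookup x (i :: nat)" for x :: "nat \<Rightarrow>\<^sub>0 real"
proof -
  have "finite {i. r * Poly_Mapping.lookup x i \<noteq> 0}"
    by (rule finite_subset[OF _ finite_lookup[of x]]) auto
  then show ?thesis by (simp add: scaleR_poly_mapping_def)
qed

definition coord_sum :: "nat set \<Rightarrow> (nat \<Rightarrow>\<^sub>0 real) \<Rightarrow> real"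
  where "coord_sum U x = (\<Sum>i\<in>U. Poly_Mapping.lookup x i)"

lemma linear_coord_sum: "linear (coord_sum U)"
  by (rule linearI) (simp_all add: coord_sum_def lookup_add sum.distrib sum_distrib_left)

lemma coord_space_iff: "x \<in> coord_space d \<longleftrightarrow> (\<forall>i. i \<notin> {1..d} \<longrightarrow> Poly_Mapping.lookup x i = 0)"
  by (auto simp: coord_space_def in_keys_iff subset_iff)

lemma sum_hyperplane_iff:
  "x \<in> sum_hyperplane d \<longleftrightarrow> x \<in> coord_space d \<and> coord_sum {1..d} x = triangular d"
  by (simp add: sum_hyperplane_def coord_sum_def triangular_def)

lemma affine_sum_hyperplane: "affine (sum_hyperplane d)"
  unfolding affine_def
proof (intro ballI allI impI)
  fix x y :: "nat \<Rightarrow>\<^sub>0 real" and u v :: real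
  assume h: "x \<in> sum_hyperplane d" "y \<in> sum_hyperplane d" "u + v = 1"
  have "coord_sum {1..d} (u *\<^sub>R x + v *\<^sub>R y) = u * triangular d + v * triangular d"
    using h by (simp add: linear_add[OF linear_coord_sum] linear_cmul[OF linear_coord_sum] sum_hyperplane_iff)
  also have "\<dots> = triangular d" using h(3) by (metis distrib_right mult_1)
  finally show "u *\<^sub>R x + v *\<^sub>R y \<in> sum_hyperplane d"
    using h by (simp add: sum_hyperplane_iff coord_space_iff lookup_add)
qed

section \<open>The constraints and the shades of rank m + n - 2\<close>

definition final_sets :: "nat \<Rightarrow> nat \<Rightarrow> nat set set"
  where "final_sets m n = {U. U \<subseteq> {1..m + n} \<and> final m (m + n) U}"

text \<open>Besides genuine facets this contains \<open>{}\<close> and \<open>{1..m + n}\<close>,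
  whose constraints are tight on the whole hyperplane and supply the two ends of each chain. The
  singleton of the position \<open>m + n\<close> is already final.\<close>

definition facets :: "nat \<Rightarrow> nat \<Rightarrow> nat set set"
  where "facets m n = final_sets m n \<union> {{q} | q. m < q \<and> q < m + n}"

lemma facets_subset: "U \<in> facets m n \<Longrightarrow> U \<subseteq> {1..m + n}"
  by (auto simp: facets_def final_sets_def)

lemma finite_facets: "finite (facets m n)"
  by (rule finite_subset[of _ "Pow {1..m + n}"]) (use facets_subset in auto)

lemma interval_split: "{1..m + n} = {1..m} \<union> {m<..m + n :: nat}"
  by auto

text \<open>Every coordinate is thus bounded below, so a line moving weight between two coordinates
  leaves the polyhedron at both ends.\<close>

lemma singleton_facet: "b \<in> {1..m + n} \<Longrightarrow> {b} \<in> facets m n"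
  by (cases "m < b \<and> b < m + n") (auto simp: facets_def final_sets_def final_def)

lemma singleton_not_final: "m < q \<Longrightarrow> q < m + n \<Longrightarrow> {q} \<notin> final_sets m n"
proof
  assume q: "m < q" "q < m + n" and "{q} \<in> final_sets m n"
  then have "final m (m + n) {q}" by (simp add: final_sets_def)
  then have "Suc q \<in> {q}" using q unfolding final_def by (meson Suc_leI insertI1 le_SucI order_refl)
  then show False by simp
qed

lemma final_setsE:
  assumes "U \<in> final_sets m n"
  obtains A e where "A \<subseteq> {1..m}" "m \<le> e" "e \<le> m + n" "U = A \<union> {e<..m + n}"
proof -
  have "final m (m + n) U" "U \<subseteq> {1..m} \<union> {m<..m + n}"
    using assms unfolding final_sets_def interval_split[symmetric] by auto
  then obtain e where "m \<le> e" "e \<le> m + n" "U = (U \<inter> {1..m}) \<union> {e<..m + n}"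
    using final_split[of m "m + n" U "{1..m}"] by auto
  then show ?thesis using that[of "U \<inter> {1..m}" e] by blast
qed

lemma final_sets_card:
  fixes A :: "nat set"
  assumes "A \<subseteq> {1..m}" "m \<le> e"
  shows "card (A \<union> {e<..m + n}) = card A + card {e<..m + n}"
proof -
  have "finite A" using assms(1) by (rule finite_subset) simp
  moreover have "A \<inter> {e<..m + n} = {}" using assms by fastforce
  ultimately show ?thesis by (simp add: card_Un_disjoint)
qed

lemma sum_eq_length: "\<forall>x\<in>set s. 0 < x \<Longrightarrow> length s \<le> sum_list s" for s :: "nat list"
  by (induction s) auto

lemma sum_Suc_length_unique_two:
  fixes s :: "nat list"
  assumes "\<forall>x\<in>set s. 0 < x" "sum_list s = Suc (length s)"
  shows "\<exists>i<length s. \<forall>j<length s. s ! j = 2 \<longleftrightarrow> j = i"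
  using assms
proof (induction s)
  case (Cons a s)
  show ?case
  proof (cases "a = 1")
    case True
    then obtain i where "i < length s" "\<forall>j<length s. s ! j = 2 \<longleftrightarrow> j = i" using Cons by auto
    then show ?thesis using True by (intro exI[of _ "Suc i"]) (auto simp: less_Suc_eq_0_disj)
  next
    case False
    then have "a = 2" "sum_list s = length s"
      using Cons.prems sum_eq_length[of s] by auto
    moreover have "s ! j = 1" if "j < length s" for j
    proof -
      have "\<forall>x\<in>set s. x = 1" if "\<forall>x\<in>set s. 0 < x" "sum_list s = length s" for s :: "nat list"
        using that
      proof (induction s)
        case (Cons b s)
        then show ?case using sum_eq_length[of s] by auto
      qed simp
      then show ?thesis using Cons.prems(1) \<open>sum_list s = length s\<close> that by auto
    qed
    ultimately show ?thesis by (intro exI[of _ 0]) (auto simp: less_Suc_eq_0_disj)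
  qed
qed simp

lemma total_length_le:
  assumes "wf_shade L S"
  shows "(\<Sum>(s, c) \<leftarrow> S. length s) \<le> entry_sum S"
  using assms
proof (induction L S rule: wf_shade.induct)
  case (2 L s c S)
  then show ?case using sum_eq_length[of s] by auto
qed simp

lemma in_shade_halfspace_iff:
  "x \<in> shade_halfspace m n S \<longleftrightarrow> x \<in> coord_space (m + n) \<and>
    triangular (card (lower_labels S) + card (lower_positions m n S)) \<le>
      coord_sum (lower_labels S \<union> lower_positions m n S) x"
  by (simp add: shade_halfspace_def coord_sum_def triangular_def Let_def)

text \<open>The rank condition says that the tuple lengths add up to
  \<open>n - 2 + length S\<close>; they add up to at most \<open>n\<close>, so there are at most two
  levels. With one level the total length is \<open>n - 1\<close>, leaving a single entry 2.\<close>

lemma lower_sets_facet: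
  assumes S: "S \<in> shades m n" "shade_rank m S = int m + int n - 2"
  shows "lower_labels S \<union> lower_positions m n S \<in> facets m n"
    and "card (lower_labels S \<union> lower_positions m n S) =
      card (lower_labels S) + card (lower_positions m n S)"
proof -
  have wf: "wf_shade {1..m} S" and n: "entry_sum S = n" using S by (auto simp: shades_iff)
  have "(\<Sum>(s, c) \<leftarrow> S. int (length s)) = int (\<Sum>(s, c) \<leftarrow> S. length s)"
    by (induction S) auto
  then have len: "int (\<Sum>(s, c) \<leftarrow> S. length s) = int n - 2 + int (length S)"
    using S(2) by (simp add: shade_rank_def)
  then have "length S \<le> 2" using total_length_le[OF wf] n by linarith
  moreover have "S \<noteq> []" using len n by auto
  ultimately consider s c where "S = [(s, c)]" | s c t b where "S = [(s, c), (t, b)]"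
    by (cases S rule: list.exhaust; cases "tl S" rule: list.exhaust; cases "tl (tl S)" rule: list.exhaust) auto
  then have "lower_labels S \<union> lower_positions m n S \<in> facets m n \<and>
    card (lower_labels S \<union> lower_positions m n S) =
      card (lower_labels S) + card (lower_positions m n S)"
  proof cases
    case 1
    then have s: "\<forall>x\<in>set s. 0 < x" "sum_list s = n" "Suc (length s) = n" using wf n len by auto
    then obtain i where i: "i < length s" "\<forall>j<length s. s ! j = 2 \<longleftrightarrow> j = i"
      using sum_Suc_length_unique_two[of s] by auto
    have "lower_positions m n S = {m + q | q. 1 \<le> q \<and> q \<le> length s \<and> s ! (q - 1) = 2}"
      using 1 by (simp add: lower_positions_def)
    also have "\<dots> = {m + Suc i}"
    proof (intro subset_antisym subsetI)
      fix p assume "p \<in> {m + q | q. 1 \<le> q \<and> q \<le> length s \<and> s ! (q - 1) = 2}"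
      then obtain q where q: "p = m + q" "1 \<le> q" "q \<le> length s" "s ! (q - 1) = 2" by auto
      then have "q - 1 = i" using i(2)[rule_format, of "q - 1"] by auto
      then show "p \<in> {m + Suc i}" using q by auto
    next
      fix p assume "p \<in> {m + Suc i}"
      then show "p \<in> {m + q | q. 1 \<le> q \<and> q \<le> length s \<and> s ! (q - 1) = 2}"
        using i by (auto intro!: exI[of _ "Suc i"])
    qed
    finally have "lower_positions m n S = {m + Suc i}" .
    moreover have "lower_labels S = {}" using 1 by (simp add: lower_labels_def)
    ultimately show ?thesis using i(1) s(3) by (simp add: facets_def)
  next
    case 2
    have c: "b \<subseteq> {1..m}" using wf 2 by auto
    have B: "lower_positions m n S = {m + length s<..m + n}" using 2 by (auto simp: lower_positions_def)
    have A: "lower_labels S = b" using 2 by (simp add: lower_labels_def)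
    have "b \<union> {m + length s<..m + n} \<in> final_sets m n"
      using c by (auto simp: final_sets_def final_def)
    then show ?thesis using final_sets_card[OF c, of "m + length s" n]
      unfolding A B facets_def by auto
  qed
  then show "lower_labels S \<union> lower_positions m n S \<in> facets m n"
    "card (lower_labels S \<union> lower_positions m n S) =
      card (lower_labels S) + card (lower_positions m n S)" by auto
qed

text \<open>All entries are 1, split at \<open>e\<close>. The set being nonempty and proper is what
  keeps an empty tuple from having no labels.\<close>

lemma facet_shade_two:
  assumes A: "A \<subseteq> {1..m}" "m \<le> e" "e \<le> m + n" and ne: "A \<union> {e<..m + n} \<noteq> {}" "A \<union> {e<..m + n} \<noteq> {1..m + n}"
  shows "\<exists>S\<in>shades m n. shade_rank m S = int m + int n - 2 \<and> lower_labels S = A \<and>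
    lower_positions m n S = {e<..m + n}"
proof -
  let ?S = "[(replicate (e - m) 1, {1..m} - A), (replicate (m + n - e) 1, A)] :: shade"
  have "wf_shade {1..m} ?S"
  proof -
    have "{1..m} - A \<noteq> {}" if "e = m"
    proof
      assume "{1..m} - A = {}"
      then have "A = {1..m}" using A by auto
      then show False using ne(2) that interval_split[of m n] by simp
    qed
    moreover have "A \<noteq> {}" if "e = m + n" using ne(1) that by simp
    moreover have "{1..m} - ({1..m} - A) = A" using A by auto
    ultimately show ?thesis using A by auto
  qed
  moreover have "entry_sum ?S = n" using A by (simp add: sum_list_replicate)
  moreover have "shade_rank m ?S = int m + int n - 2" using A by (simp add: shade_rank_def)
  moreover have "lower_labels ?S = A" by (simp add: lower_labels_def)
  moreover have "lower_positions m n ?S = {e<..m + n}" using A by (auto simp: lower_positions_def)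
  ultimately show ?thesis by (intro bexI[of _ ?S]) (auto simp: shades_iff)
qed

lemma facet_shade_one:
  assumes q: "m < q" "q < m + n"
  shows "\<exists>S\<in>shades m n. shade_rank m S = int m + int n - 2 \<and> lower_labels S = {} \<and>
    lower_positions m n S = {q}"
proof -
  \<comment> \<open>The index, counted from 0, of the entry 2; its partial sum jumps over position
    \<open>q\<close>, which becomes the marked one.\<close>
  let ?i = "q - m - 1"
  let ?s = "replicate ?i 1 @ [2] @ replicate (m + n - q - 1) (1::nat)"
  let ?S = "[(?s, {1..m})] :: shade"
  have nth: "?s ! j = 2 \<longleftrightarrow> j = ?i" if "j < length ?s" for j
    using that by (auto simp: nth_append nth_Cons split: nat.splits)
  have "lower_positions m n ?S = {m + p | p. 1 \<le> p \<and> p \<le> length ?s \<and> ?s ! (p - 1) = 2}"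
    by (simp add: lower_positions_def)
  also have "\<dots> = {m + p | p. 1 \<le> p \<and> p \<le> length ?s \<and> p - 1 = ?i}"
    using nth by (intro Collect_cong ex_cong1 conj_cong refl) (auto simp: less_eq_Suc_le)
  also have "\<dots> = {q}" using q by (auto intro!: exI[of _ "q - m"])
  finally have "lower_positions m n ?S = {q}" .
  moreover have "wf_shade {1..m} ?S" by auto
  moreover have "entry_sum ?S = n" using q by (simp add: sum_list_replicate)
  moreover have "shade_rank m ?S = int m + int n - 2" using q by (simp add: shade_rank_def)
  moreover have "lower_labels ?S = {}" by (simp add: lower_labels_def)
  ultimately show ?thesis by (intro bexI[of _ ?S]) (auto simp: shades_iff)
qed

interpretation hoch: polyhedron "sum_hyperplane (m + n)" "facets m n" coord_sum "\<lambda>U. triangular (card U)"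
  for m n
  by (intro polyhedron.intro finite_facets linear_coord_sum affine_sum_hyperplane)

text \<open>Each halfspace is one of the constraints in \<open>facets\<close>. Conversely all of
  these arise from shades, except those of \<open>{}\<close> and \<open>{1..m + n}\<close>, which
  hold on the hyperplane.\<close>

lemma hochschild_halfspaces_eq: "hochschild_halfspaces m n = hoch.pts m n"
proof (intro subset_antisym subsetI)
  fix x assume x: "x \<in> hochschild_halfspaces m n"
  then have E: "x \<in> sum_hyperplane (m + n)" by (simp add: hochschild_halfspaces_def)
  have half: "triangular (card (lower_labels S) + card (lower_positions m n S)) \<le>
      coord_sum (lower_labels S \<union> lower_positions m n S) x"
    if "S \<in> shades m n" "shade_rank m S = int m + int n - 2" for S
    using x that by (auto simp: hochschild_halfspaces_def in_shade_halfspace_iff)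
  have "triangular (card U) \<le> coord_sum U x" if "U \<in> facets m n" for U
  proof -
    from that consider "U \<in> final_sets m n" | q where "U = {q}" "m < q" "q < m + n"
      by (auto simp: facets_def)
    then show ?thesis
    proof cases
      case 1
      then obtain A e where A: "A \<subseteq> {1..m}" "m \<le> e" "e \<le> m + n" and U: "U = A \<union> {e<..m + n}"
        by (rule final_setsE)
      consider "U = {}" | "U = {1..m + n}" | "U \<noteq> {}" "U \<noteq> {1..m + n}" by blast
      then show ?thesis
      proof cases
        case 3
        then obtain S where "S \<in> shades m n" "shade_rank m S = int m + int n - 2" "lower_labels S = A"
          "lower_positions m n S = {e<..m + n}" using facet_shade_two[OF A] U by metis
        then show ?thesis using half[of S] final_sets_card[OF A(1,2), of n] U by simp
      qed (use E in \<open>auto simp: sum_hyperplane_iff coord_sum_def\<close>)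
    next
      case 2
      then obtain S where "S \<in> shades m n" "shade_rank m S = int m + int n - 2" "lower_labels S = {}"
        "lower_positions m n S = {q}" using facet_shade_one by metis
      then show ?thesis using half[of S] 2 by simp
    qed
  qed
  then show "x \<in> hoch.pts m n" using E by (simp add: hoch.pts_def)
next
  fix x assume x: "x \<in> hoch.pts m n"
  then have "x \<in> shade_halfspace m n S" if "S \<in> shades m n" "shade_rank m S = int m + int n - 2" for S
    using lower_sets_facet[OF that] by (auto simp: in_shade_halfspace_iff hoch.pts_def sum_hyperplane_iff)
  then show "x \<in> hochschild_halfspaces m n"
    using x by (auto simp: hochschild_halfspaces_def hoch.pts_def)
qed

section \<open>Sets of tight constraints as shades\<close>

definition shade_facets :: "nat \<Rightarrow> shade \<Rightarrow> nat set set"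
  where "shade_facets m S = chain m S \<union> {{q} | q. q \<in> marked m S}"

lemma shade_valid:
  assumes "S \<in> shades m n"
  shows "valid m (m + n) {1..m} (chain m S) (marked m S)"
  using valid_shade[of "{1..m}" S m] assms by (auto simp: shades_iff)

lemma ground_shade: "S \<in> shades m n \<Longrightarrow> ground m S = {1..m + n}"
  using ground_eq[of "{1..m}" S m] by (auto simp: shades_iff)

lemma final_facet: "U \<in> final_sets m n \<Longrightarrow> U \<in> facets m n"
  by (simp add: facets_def)

lemma chain_final: "S \<in> shades m n \<Longrightarrow> chain m S \<subseteq> final_sets m n"
  using shade_valid[of S m n] unfolding valid_def final_sets_def interval_split by auto

lemma marked_between: "S \<in> shades m n \<Longrightarrow> q \<in> marked m S \<Longrightarrow> m < q \<and> q < m + n"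
  using shade_valid[of S m n] by (auto simp: valid_def)

text \<open>The singleton of a marked position is not final, so one set of constraints stores both
  kinds of data without confusion.\<close>

lemma shade_facets_split:
  assumes "S \<in> shades m n"
  shows "shade_facets m S \<inter> final_sets m n = chain m S"
    and "{q. m < q \<and> q < m + n \<and> {q} \<in> shade_facets m S} = marked m S"
proof -
  have 1: "{q} \<notin> final_sets m n" if "q \<in> marked m S" for q
    using marked_between[OF assms that] singleton_not_final by blast
  then show "shade_facets m S \<inter> final_sets m n = chain m S"
    using chain_final[OF assms] by (auto simp: shade_facets_def)
  have "{q} \<notin> chain m S" if "m < q" "q < m + n" for q
    using singleton_not_final[OF that] chain_final[OF assms] by blast
  then show "{q. m < q \<and> q < m + n \<and> {q} \<in> shade_facets m S} = marked m S"
    using marked_between[OF assms] by (auto simp: shade_facets_def)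
qed

lemma shade_facets_subset_iff:
  assumes "S \<in> shades m n" "T \<in> shades m n"
  shows "shade_facets m T \<subseteq> shade_facets m S \<longleftrightarrow> preposet m S \<subseteq> preposet m T"
proof -
  have pre: "preposet m S = chain_preposet ({1..m} \<union> {m<..m + n}) (chain m S) (marked m S)"
    if "S \<in> shades m n" for S
    using preposet_eq[of "{1..m}" S m] ground_shade[OF that] that interval_split
    by (auto simp: shades_iff)
  have "preposet m S \<subseteq> preposet m T \<longleftrightarrow> chain m T \<subseteq> chain m S \<and> marked m T \<subseteq> marked m S"
    unfolding pre[OF assms(1)] pre[OF assms(2)]
    by (rule chain_preposet_subset_iff[OF shade_valid shade_valid]) (use assms in auto)
  also have "\<dots> \<longleftrightarrow> shade_facets m T \<subseteq> shade_facets m S"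
  proof
    assume "shade_facets m T \<subseteq> shade_facets m S"
    then show "chain m T \<subseteq> chain m S \<and> marked m T \<subseteq> marked m S"
      using shade_facets_split[OF assms(1)] shade_facets_split[OF assms(2)] by blast
  qed (auto simp: shade_facets_def)
  finally show ?thesis ..
qed

lemma shade_facets_inj:
  assumes "S \<in> shades m n" "T \<in> shades m n" "shade_facets m S = shade_facets m T"
  shows "S = T"
proof (rule shade_inj[of "{1..m}" S T m])
  show "chain m S = chain m T" "marked m S = marked m T"
    using shade_facets_split[OF assms(1)] shade_facets_split[OF assms(2)] assms(3) by auto
qed (use assms in \<open>auto simp: shades_iff\<close>)

definition face_point :: "nat \<Rightarrow> nat \<Rightarrow> shade \<Rightarrow> (nat \<Rightarrow>\<^sub>0 real)"
  where "face_point m n S = (\<Sum>p = 1..m + n. Poly_Mapping.single p (weight m S p))"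

lemma lookup_face_point:
  assumes "S \<in> shades m n"
  shows "Poly_Mapping.lookup (face_point m n S) = weight m S"
proof
  fix i
  have "Poly_Mapping.lookup (face_point m n S) i = (\<Sum>p = 1..m + n. if p = i then weight m S p else 0)"
    unfolding face_point_def lookup_sum by (rule sum.cong) (auto simp: lookup_single when_def)
  also have "\<dots> = weight m S i"
    using weight_outside[of i m S] ground_shade[OF assms] by auto
  finally show "Poly_Mapping.lookup (face_point m n S) i = weight m S i" .
qed

lemma face_point_unary:
  assumes "S \<in> unary_shades m n"
  shows "face_point m n S = shade_point m n S"
  unfolding face_point_def shade_point_def
  by (rule sum.cong) (use point_coord_eq_weight[OF assms] in auto)

text \<open>No further constraint being tight, this point lies on the face of another shade only if
  the constraints of that shade are among those of \<open>S\<close>.\<close>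

lemma face_point_facets:
  assumes S: "S \<in> shades m n"
  shows "face_point m n S \<in> hoch.pts m n" "hoch.tight m n (face_point m n S) = shade_facets m S"
proof -
  let ?x = "face_point m n S"
  have wf: "wf_shade {1..m} S" "{1..m} \<subseteq> {..m}" "entry_sum S = n" using S by (auto simp: shades_iff)
  have cs: "coord_sum U ?x = sum (weight m S) U" for U
    by (simp add: coord_sum_def lookup_face_point[OF S])
  have fs: "triangular (card U) \<le> coord_sum U ?x"
    "coord_sum U ?x = triangular (card U) \<longleftrightarrow> U \<in> chain m S" if "U \<in> final_sets m n" for U
    unfolding cs using weight_sum[OF wf(1,2), of U] that wf(3) ground_shade[OF S]
    by (auto simp: final_sets_def)
  have sg: "1 \<le> coord_sum {q} ?x" "coord_sum {q} ?x = 1 \<longleftrightarrow> q \<in> marked m S"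
    if "m < q" "q < m + n" for q
    unfolding cs using weight_marked[OF wf(1,2), of q] that wf(3) by auto
  have "coord_sum {1..m + n} ?x = triangular (m + n)"
    using fs(2)[of "{1..m + n}"] chain_ground[of m S] chain_final[OF S] ground_shade[OF S] by auto
  moreover have "?x \<in> coord_space (m + n)"
    using weight_outside[of _ m S] ground_shade[OF S] by (auto simp: coord_space_iff lookup_face_point[OF S])
  ultimately have "?x \<in> sum_hyperplane (m + n)" by (simp add: sum_hyperplane_iff)
  moreover have "triangular (card U) \<le> coord_sum U ?x" if "U \<in> facets m n" for U
    using that fs(1) sg(1) by (auto simp: facets_def)
  ultimately show "?x \<in> hoch.pts m n" by (simp add: hoch.pts_def)
  show "hoch.tight m n ?x = shade_facets m S"
  proof (intro subset_antisym subsetI)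
    fix U assume "U \<in> hoch.tight m n ?x"
    then have "U \<in> facets m n" "coord_sum U ?x = triangular (card U)" by (auto simp: hoch.tight_def)
    then show "U \<in> shade_facets m S" using fs(2) sg(2) by (auto simp: facets_def shade_facets_def)
  next
    fix U assume "U \<in> shade_facets m S"
    then consider "U \<in> chain m S" | q where "U = {q}" "q \<in> marked m S" by (auto simp: shade_facets_def)
    then show "U \<in> hoch.tight m n ?x"
    proof cases
      case 1
      then have "U \<in> final_sets m n" using chain_final[OF S] by auto
      then show ?thesis using fs(2)[of U] 1 final_facet by (auto simp: hoch.tight_def)
    next
      case 2
      then show ?thesis using marked_between[OF S 2(2)] sg(2)[of q] facets_subset[of U m n]
        singleton_facet[of q m n] by (auto simp: hoch.tight_def)
    qed
  qed
qed

text \<open>The two sides differ by \<open>p * q\<close>, where \<open>p\<close> and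
  \<open>q\<close> are the sizes of \<open>U - V\<close> and \<open>V - U\<close>.\<close>

lemma triangular_supermodular:
  assumes "finite U" "finite V" "\<not> U \<subseteq> V" "\<not> V \<subseteq> U"
  shows "triangular (card U) + triangular (card V) < triangular (card (U \<inter> V)) + triangular (card (U \<union> V))"
proof -
  define a p q where "a = card (U \<inter> V)" and "p = card (U - V)" and "q = card (V - U)"
  have "p > 0" "q > 0" using assms by (auto simp: p_def q_def card_gt_0_iff)
  then have "real p * real q > 0" by simp
  moreover have "card U = a + p" "card V = a + q" "card (U \<union> V) = a + p + q"
  proof -
    show U: "card U = a + p" and V: "card V = a + q"
      using card_Int_Diff assms by (metis a_def p_def, metis a_def q_def Int_commute)
    show "card (U \<union> V) = a + p + q" using card_Un_Int[OF assms(1,2)] U V by (simp add: a_def)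
  qed
  ultimately show ?thesis unfolding a_def[symmetric] by (simp add: triangular_eq field_simps)
qed

text \<open>Strict supermodularity of \<open>triangular\<close> makes the tight final sets a chain, and a coordinate just
  above a nonempty tight final set is larger than \<open>1\<close>.\<close>
lemma tight_realizable:
  assumes x: "x \<in> hoch.pts m n"
  obtains S where "S \<in> shades m n" "hoch.tight m n x = shade_facets m S"
proof -
  let ?T = "hoch.tight m n x"
  let ?C = "?T \<inter> final_sets m n" and ?Q = "{q. m < q \<and> q < m + n \<and> {q} \<in> ?T}"
  have ge: "triangular (card U) \<le> coord_sum U x" if "U \<in> final_sets m n" for U
    using x final_facet[OF that] by (auto simp: hoch.pts_def)
  have C: "U \<in> ?C \<longleftrightarrow> U \<in> final_sets m n \<and> coord_sum U x = triangular (card U)" for U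
    by (auto simp: hoch.tight_def final_facet)
  have fin: "finite U" if "U \<in> final_sets m n" for U
    using that by (auto simp: final_sets_def intro: finite_subset)
  have "valid m (m + n) {1..m} ?C ?Q"
    unfolding valid_def interval_split[symmetric]
  proof (intro conjI ballI impI)
    show "{} \<in> ?C" unfolding C by (auto simp: final_sets_def final_def coord_sum_def)
    show "{1..m + n} \<in> ?C"
      unfolding C using x by (auto simp: final_sets_def final_def hoch.pts_def sum_hyperplane_iff)
    show "U \<subseteq> {1..m + n}" "final m (m + n) U" if "U \<in> ?C" for U
      using that by (auto simp: final_sets_def)
    show "U \<subseteq> V \<or> V \<subseteq> U" if "U \<in> ?C" "V \<in> ?C" for U V
    proof (rule ccontr)
      assume n: "\<not> (U \<subseteq> V \<or> V \<subseteq> U)"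
      have UV: "U \<in> final_sets m n" "V \<in> final_sets m n" "coord_sum U x = triangular (card U)"
        "coord_sum V x = triangular (card V)" using that C by auto
      have "U \<inter> V \<in> final_sets m n" "U \<union> V \<in> final_sets m n"
        using UV(1,2) unfolding final_sets_def final_def by blast+
      then have "triangular (card (U \<inter> V)) + triangular (card (U \<union> V)) \<le> coord_sum (U \<inter> V) x + coord_sum (U \<union> V) x"
        using ge by (simp add: add_mono)
      also have "\<dots> = coord_sum U x + coord_sum V x"
        using sum.union_inter[OF fin fin, OF UV(1,2)] by (simp add: coord_sum_def add.commute)
      finally show False using triangular_supermodular[of U V] n fin UV by auto
    qed
    show "?Q \<subseteq> {m<..<m + n}" by auto
    show "q \<in> U" if U: "U \<in> ?C" and q: "q \<in> ?Q" and sq: "Suc q \<in> U" for U q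
    proof (rule ccontr)
      assume n: "q \<notin> U"
      have UF: "U \<in> final_sets m n" and eqU: "coord_sum U x = triangular (card U)" using U C by auto
      have eqq: "Poly_Mapping.lookup x q = 1" using q by (auto simp: hoch.tight_def coord_sum_def)
      have qF: "insert q U \<in> final_sets m n"
        unfolding final_sets_def final_def
      proof (intro CollectI conjI allI impI)
        show "insert q U \<subseteq> {1..m + n}" using UF q by (auto simp: final_sets_def)
        fix p r assume pr: "m < p" "p \<le> r" "r \<le> m + n" "p \<in> insert q U"
        have F: "\<And>p r. m < p \<Longrightarrow> p \<le> r \<Longrightarrow> r \<le> m + n \<Longrightarrow> p \<in> U \<Longrightarrow> r \<in> U"
          using UF by (auto simp: final_sets_def final_def)
        show "r \<in> insert q U"
        proof (cases "p = q")
          case True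
          then show ?thesis using F[of "Suc q" r] pr sq by (cases "r = q") auto
        qed (use F[of p r] pr in auto)
      qed
      have "coord_sum (insert q U) x = 1 + triangular (card U)"
        using n fin[OF UF] eqU eqq by (simp add: coord_sum_def)
      moreover have "card (insert q U) = Suc (card U)" using n fin[OF UF] by simp
      moreover have "card U > 0" using fin[OF UF] sq by (auto simp: card_gt_0_iff)
      \<comment> \<open>The bound for \<open>insert q U\<close> exceeds that for \<open>U\<close> by
        \<open>card U + 1 > 1\<close>, but the coordinate \<open>q\<close> adds only 1.\<close>
      ultimately show False using ge[OF qF] by (simp add: triangular_eq field_simps)
    qed
  qed
  then obtain S where S: "wf_shade {1..m} S" "m + entry_sum S = m + n" "chain m S = ?C" "marked m S = ?Q"
    using valid_realizable[of m "m + n" "{1..m}" ?C ?Q] by auto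
  have "?T \<subseteq> facets m n" by (auto simp: hoch.tight_def)
  then have "?T = shade_facets m S" using S(3,4) by (auto simp: shade_facets_def facets_def)
  then show ?thesis using that[of S] S by (simp add: shades_iff)
qed

section \<open>Vertices and the convex hull\<close>

lemma unary_face:
  assumes S: "S \<in> unary_shades m n" and x: "x \<in> hoch.face m n (shade_facets m S)"
  shows "x = shade_point m n S"
proof -
  have S': "S \<in> shades m n" "unary S" using S by (auto simp: unary_shades_iff)
  have wf: "wf_shade {1..m} S" "{1..m} \<subseteq> {..m}" using S' by (auto simp: shades_iff)
  have xP: "x \<in> hoch.pts m n" and T: "shade_facets m S \<subseteq> hoch.tight m n x"
    using x by (auto simp: hoch.face_def)
  \<comment> \<open>The difference from the averaged point, to which \<open>unary_unique\<close>
    applies because both points are tight on \<open>shade_facets m S\<close>.\<close>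
  let ?z = "\<lambda>i. Poly_Mapping.lookup x i - weight m S i"
  note P = face_point_facets[OF S'(1)]
  have eq: "coord_sum U x = coord_sum U (face_point m n S)" if "U \<in> shade_facets m S" for U
  proof -
    have "U \<in> hoch.tight m n x" "U \<in> hoch.tight m n (face_point m n S)" using T P(2) that by blast+
    then show ?thesis by (simp add: hoch.tight_def)
  qed
  have sz: "sum ?z U = 0" if "U \<in> shade_facets m S" for U
    using eq[OF that] by (simp add: coord_sum_def sum_subtractf lookup_face_point[OF S'(1)])
  have "\<forall>a\<in>ground m S. ?z a = 0"
  proof (rule unary_unique[OF wf S'(2)])
    show "sum ?z U = 0" if "U \<in> chain m S" for U using sz that by (simp add: shade_facets_def)
    show "?z q = 0" if "q \<in> marked m S" for q using sz[of "{q}"] that by (auto simp: shade_facets_def)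
  qed
  moreover have "?z a = 0" if "a \<notin> ground m S" for a
    using that weight_outside[OF that] xP ground_shade[OF S'(1)]
    by (auto simp: hoch.pts_def sum_hyperplane_iff coord_space_iff)
  ultimately have "Poly_Mapping.lookup x = Poly_Mapping.lookup (face_point m n S)"
    unfolding lookup_face_point[OF S'(1)] by (auto simp: fun_eq_iff)
  then have "x = face_point m n S" by (simp only: poly_mapping.lookup_inject)
  then show ?thesis using face_point_unary[OF S] by simp
qed

lemma hochschild_hull_eq: "hochschild_hull m n = hoch.pts m n"
proof
  have "shade_point m n ` unary_shades m n \<subseteq> hoch.pts m n"
    using face_point_facets(1) face_point_unary by (force simp: unary_shades_iff)
  then show "hochschild_hull m n \<subseteq> hoch.pts m n"
    unfolding hochschild_hull_def using hoch.convex_pts by (rule hull_minimal)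
  show "hoch.pts m n \<subseteq> hochschild_hull m n"
    unfolding hochschild_hull_def
  proof (rule hoch.pts_subset_hull)
    fix x assume x: "x \<in> hoch.pts m n"
    obtain S where S: "S \<in> shades m n" "hoch.tight m n x = shade_facets m S"
      using tight_realizable[OF x] .
    show "x \<in> shade_point m n ` unary_shades m n \<or>
      (\<exists>v. (\<forall>t. x + t *\<^sub>R v \<in> sum_hyperplane (m + n)) \<and> (\<forall>U\<in>hoch.tight m n x. coord_sum U v = 0) \<and>
        (\<exists>U\<in>facets m n. coord_sum U v < 0) \<and> (\<exists>U\<in>facets m n. 0 < coord_sum U v))"
    proof (cases "unary S")
      case True
      then have "S \<in> unary_shades m n" using S by (simp add: unary_shades_iff)
      moreover have "x \<in> hoch.face m n (shade_facets m S)" using x S by (simp add: hoch.face_def)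
      ultimately show ?thesis using unary_face by blast
    next
      case False
      then obtain a b where ab: "a \<noteq> b" "a \<in> ground m S - marked m S" "b \<in> ground m S - marked m S"
        "\<forall>U\<in>chain m S. a \<in> U \<longleftrightarrow> b \<in> U"
        using not_unary_direction[of "{1..m}" S m] S(1) by (auto simp: shades_iff)
      have ab_range: "a \<in> {1..m + n}" "b \<in> {1..m + n}" using ab(2,3) ground_shade[OF S(1)] by auto
      \<comment> \<open>Transferring weight between \<open>a\<close> and \<open>b\<close> keeps the
        sum over each member of the chain, which contains both or neither, and keeps all marked
        coordinates, as \<open>a\<close> and \<open>b\<close> are unmarked.\<close>
      define v :: "nat \<Rightarrow>\<^sub>0 real" where "v = Poly_Mapping.single a 1 - Poly_Mapping.single b 1"
      have lv: "Poly_Mapping.lookup v i = (if i = a then 1 else 0) - (if i = b then 1 else 0)" for i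
        by (simp add: v_def lookup_minus lookup_single when_def)
      have cv: "coord_sum U v = (if a \<in> U then 1 else 0) - (if b \<in> U then 1 else 0)" if "finite U" for U
        using that by (simp add: coord_sum_def lv sum_subtractf)
      have "x + t *\<^sub>R v \<in> sum_hyperplane (m + n)" for t
        using x ab_range unfolding hoch.pts_def sum_hyperplane_iff coord_space_iff
        by (auto simp: lookup_add lv cv linear_add[OF linear_coord_sum] linear_cmul[OF linear_coord_sum])
      moreover have "coord_sum U v = 0" if "U \<in> hoch.tight m n x" for U
      proof -
        have "finite U" using facets_subset[of U m n] that finite_subset by (auto simp: hoch.tight_def)
        then show ?thesis using that ab unfolding S(2) by (auto simp: cv shade_facets_def)
      qed
      moreover have "coord_sum {a} v > 0" "coord_sum {b} v < 0" using ab(1) by (simp_all add: cv)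
      ultimately show ?thesis using singleton_facet ab_range by blast
    qed
  qed
qed

lemma extreme_points_hochschild:
  "{x. x extreme_point_of hochschild_hull m n} = shade_point m n ` unary_shades m n"
proof
  show "{x. x extreme_point_of hochschild_hull m n} \<subseteq> shade_point m n ` unary_shades m n"
    unfolding hochschild_hull_def by (auto dest: extreme_point_of_convex_hull)
  show "shade_point m n ` unary_shades m n \<subseteq> {x. x extreme_point_of hochschild_hull m n}"
  proof clarify
    fix S assume S: "S \<in> unary_shades m n"
    then have "shade_point m n S \<in> hoch.face m n (shade_facets m S)"
      using face_point_facets[of S m n] face_point_unary[OF S]
      by (simp add: hoch.face_def unary_shades_iff)
    then have "hoch.face m n (shade_facets m S) = {shade_point m n S}"
      using unary_face[OF S] by blast
    then show "shade_point m n S extreme_point_of hochschild_hull m n"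
      using hoch.face_of_face[of m n "shade_facets m S"]
      by (simp add: hochschild_hull_eq face_of_singleton)
  qed
qed

lemma polytope_hochschild: "polytope (hochschild_hull m n)"
proof -
  have "finite (unary_shades m n)"
    using finite_shades by (rule finite_subset[rotated]) (auto simp: unary_shades_def)
  then show ?thesis unfolding polytope_def hochschild_hull_def by blast
qed

section \<open>The isomorphism with the face lattice\<close>

fun shade_face :: "nat \<Rightarrow> nat \<Rightarrow> shade option \<Rightarrow> (nat \<Rightarrow>\<^sub>0 real) set"
  where
    "shade_face m n None = {}"
  | "shade_face m n (Some S) = hoch.face m n (shade_facets m S)"

text \<open>Inclusion of faces is decided at \<open>face_point m n S\<close>, whose tight
  constraints are exactly those of \<open>S\<close>. A coarser shade imposes fewer constraints, so
  its face is larger.\<close>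

lemma shade_face_subset_iff:
  assumes "X \<in> carrier (coarsening_lattice m n)" "Y \<in> carrier (coarsening_lattice m n)"
  shows "shade_face m n X \<subseteq> shade_face m n Y \<longleftrightarrow> coarsening_le m X Y"
proof -
  have mem: "face_point m n S \<in> hoch.face m n (shade_facets m S)" if "S \<in> shades m n" for S
    using face_point_facets[OF that] by (simp add: hoch.face_def)
  show ?thesis
  proof (cases X)
    case (Some S)
    then have S: "S \<in> shades m n" using assms(1) by (auto simp: coarsening_lattice_def)
    show ?thesis
    proof (cases Y)
      case None
      then show ?thesis using Some mem[OF S] by auto
    next
      case (Some T)
      then have T: "T \<in> shades m n" using assms(2) by (auto simp: coarsening_lattice_def)
      have "hoch.face m n (shade_facets m S) \<subseteq> hoch.face m n (shade_facets m T) \<longleftrightarrow>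
        shade_facets m T \<subseteq> shade_facets m S"
        using mem[OF S] face_point_facets(2)[OF S] by (auto simp: hoch.face_def)
      then show ?thesis using \<open>X = Some S\<close> Some shade_facets_subset_iff[OF S T] by simp
    qed
  qed simp
qed

lemma shade_face_bij:
  "bij_betw (shade_face m n) (carrier (coarsening_lattice m n)) (carrier (face_lattice (hochschild_hull m n)))"
  unfolding bij_betw_def
proof
  show "inj_on (shade_face m n) (carrier (coarsening_lattice m n))"
  proof (rule inj_onI)
    fix X Y assume XY: "X \<in> carrier (coarsening_lattice m n)" "Y \<in> carrier (coarsening_lattice m n)"
      "shade_face m n X = shade_face m n Y"
    then have le: "coarsening_le m X Y" "coarsening_le m Y X"
      using shade_face_subset_iff[OF XY(1,2)] shade_face_subset_iff[OF XY(2,1)] by simp_all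
    show "X = Y"
    proof (cases X; cases Y)
      fix S T assume ST: "X = Some S" "Y = Some T"
      then have "S \<in> shades m n" "T \<in> shades m n" using XY by (auto simp: coarsening_lattice_def)
      moreover from this have "shade_facets m S = shade_facets m T"
        using le ST shade_facets_subset_iff[of S m n T] shade_facets_subset_iff[of T m n S] by auto
      ultimately show ?thesis using ST shade_facets_inj by simp
    qed (use le in auto)
  qed
  show "shade_face m n ` carrier (coarsening_lattice m n) = carrier (face_lattice (hochschild_hull m n))"
  proof
    show "shade_face m n ` carrier (coarsening_lattice m n) \<subseteq> carrier (face_lattice (hochschild_hull m n))"
      using hoch.face_of_face[of m n]
      by (auto simp: coarsening_lattice_def face_lattice_def hochschild_hull_eq)
    show "carrier (face_lattice (hochschild_hull m n)) \<subseteq> shade_face m n ` carrier (coarsening_lattice m n)"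
    proof
      fix F assume "F \<in> carrier (face_lattice (hochschild_hull m n))"
      then have F: "F face_of hoch.pts m n" by (simp add: face_lattice_def hochschild_hull_eq)
      show "F \<in> shade_face m n ` carrier (coarsening_lattice m n)"
      proof (cases "F = {}")
        case True
        then show ?thesis by (intro image_eqI[of _ _ None]) (auto simp: coarsening_lattice_def)
      next
        case False
        then obtain x where "x \<in> hoch.pts m n" "F = hoch.face m n (hoch.tight m n x)"
          using hoch.face_of_cases[OF F] by metis
        moreover from this obtain S where "S \<in> shades m n" "hoch.tight m n x = shade_facets m S"
          using tight_realizable by metis
        ultimately show ?thesis
          by (intro image_eqI[of _ _ "Some S"]) (auto simp: coarsening_lattice_def)
      qed
    qed
  qed
qed

lemma partial_order_coarsening: "partial_order (coarsening_lattice m n)"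
proof -
  let ?L = "coarsening_lattice m n"
  note iff = shade_face_subset_iff[of _ m n]
  have le: "X \<sqsubseteq>\<^bsub>?L\<^esub> Y \<longleftrightarrow> coarsening_le m X Y" "X .=\<^bsub>?L\<^esub> Y \<longleftrightarrow> X = Y" for X Y
    by (simp_all add: coarsening_lattice_def)
  show ?thesis
  proof (unfold_locales, unfold le)
    fix X Y Z assume X: "X \<in> carrier ?L"
    show "coarsening_le m X X" using iff[OF X X] by simp
    assume Y: "Y \<in> carrier ?L"
    { assume "coarsening_le m X Y" "coarsening_le m Y X"
      then have "shade_face m n X = shade_face m n Y" using iff[OF X Y] iff[OF Y X] by simp
      then show "X = Y" using shade_face_bij[of m n] X Y by (auto simp: bij_betw_def dest: inj_onD) }
    assume Z: "Z \<in> carrier ?L" and "coarsening_le m X Y" "coarsening_le m Y Z"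
    then show "coarsening_le m X Z" using iff[OF X Y] iff[OF Y Z] iff[OF X Z] by auto
  qed (auto simp: coarsening_lattice_def)
qed

lemma partial_order_face_lattice: "partial_order (face_lattice P)"
  by unfold_locales (auto simp: face_lattice_def)

text \<open>Transported from the faces: the meet is the intersection, the join is the intersection
  of all faces containing both.\<close>

lemma lattice_coarsening: "lattice (coarsening_lattice m n)"
proof -
  let ?L = "coarsening_lattice m n" and ?P = "hochschild_hull m n" and ?\<phi> = "shade_face m n"
  note iff = shade_face_subset_iff[of _ m n]
  have le: "X \<sqsubseteq>\<^bsub>?L\<^esub> Y \<longleftrightarrow> coarsening_le m X Y" for X Y by (simp add: coarsening_lattice_def)
  have face: "?\<phi> X face_of ?P" if "X \<in> carrier ?L" for X
    using bij_betwE[OF shade_face_bij[of m n]] that by (auto simp: face_lattice_def)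
  have onto: "\<exists>X\<in>carrier ?L. ?\<phi> X = F" if "F face_of ?P" for F
  proof -
    have "F \<in> ?\<phi> ` carrier ?L"
      using bij_betw_imp_surj_on[OF shade_face_bij[of m n]] that by (simp add: face_lattice_def)
    then show ?thesis by blast
  qed
  have convex: "convex ?P" by (simp add: hochschild_hull_def)
  show ?thesis
  proof (intro lattice.intro upper_semilattice.intro upper_semilattice_axioms.intro
      lower_semilattice.intro lower_semilattice_axioms.intro partial_order_coarsening)
    fix X Y assume XY: "X \<in> carrier ?L" "Y \<in> carrier ?L"
    have lower: "Lower ?L {X, Y} = {Z \<in> carrier ?L. coarsening_le m Z X \<and> coarsening_le m Z Y}"
      unfolding Lower_def le using XY by blast
    obtain I where I: "I \<in> carrier ?L" "?\<phi> I = ?\<phi> X \<inter> ?\<phi> Y"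
      using onto[OF face_of_Int[OF face[OF XY(1)] face[OF XY(2)]]] by blast
    have "coarsening_le m I X" "coarsening_le m I Y"
      using iff[OF I(1) XY(1)] iff[OF I(1) XY(2)] I(2) by simp_all
    moreover have "coarsening_le m Z I"
      if Z: "Z \<in> carrier ?L" and "coarsening_le m Z X" "coarsening_le m Z Y" for Z
    proof -
      have "?\<phi> Z \<subseteq> ?\<phi> X" "?\<phi> Z \<subseteq> ?\<phi> Y"
        using iff[OF Z XY(1)] iff[OF Z XY(2)] that by simp_all
      then have "?\<phi> Z \<subseteq> ?\<phi> I" unfolding I(2) by (rule Int_greatest)
      then show ?thesis using iff[OF Z I(1)] by simp
    qed
    ultimately show "\<exists>s. greatest ?L s (Lower ?L {X, Y})"
      using I(1) unfolding greatest_def lower le by (intro exI[of _ I]) simp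
  next
    fix X Y assume XY: "X \<in> carrier ?L" "Y \<in> carrier ?L"
    have upper: "Upper ?L {X, Y} = {Z \<in> carrier ?L. coarsening_le m X Z \<and> coarsening_le m Y Z}"
      unfolding Upper_def le using XY by blast
    define A where "A = {F. F face_of ?P \<and> ?\<phi> X \<subseteq> F \<and> ?\<phi> Y \<subseteq> F}"
    \<comment> \<open>An intersection of faces is a face only for a nonempty family.\<close>
    have "?P \<in> A" unfolding A_def
      using face_of_refl[OF convex] face_of_imp_subset[OF face[OF XY(1)]]
        face_of_imp_subset[OF face[OF XY(2)]] by simp
    then have "\<Inter>A face_of ?P" by (intro face_of_Inter) (auto simp: A_def)
    from onto[OF this] obtain J where J: "J \<in> carrier ?L" "?\<phi> J = \<Inter>A" by blast
    have "?\<phi> X \<subseteq> ?\<phi> J" "?\<phi> Y \<subseteq> ?\<phi> J" unfolding J(2) by (auto simp: A_def)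
    then have "coarsening_le m X J" "coarsening_le m Y J"
      using iff[OF XY(1) J(1)] iff[OF XY(2) J(1)] by simp_all
    moreover have "coarsening_le m J Z"
      if Z: "Z \<in> carrier ?L" and "coarsening_le m X Z" "coarsening_le m Y Z" for Z
    proof -
      have "?\<phi> Z \<in> A" unfolding A_def
        using iff[OF XY(1) Z] iff[OF XY(2) Z] that face[OF Z] by simp
      then have "?\<phi> J \<subseteq> ?\<phi> Z" unfolding J(2) by (rule Inter_lower)
      then show ?thesis using iff[OF J(1) Z] by simp
    qed
    ultimately show "\<exists>s. least ?L s (Upper ?L {X, Y})"
      using J(1) unfolding least_def upper le by (intro exI[of _ J]) simp
  qed
qed

lemma order_isomorphic_coarsening:
  "order_isomorphic (coarsening_lattice m n) (face_lattice (hochschild_hull m n))"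
  unfolding order_isomorphic_def order_emb_def
proof (intro exI[of _ "shade_face m n"] conjI ballI)
  show "weak_partial_order (coarsening_lattice m n)"
    using partial_order_coarsening by (rule partial_order.axioms(1))
  show "weak_partial_order (face_lattice (hochschild_hull m n))"
    using partial_order_face_lattice by (rule partial_order.axioms(1))
  fix X Y assume "X \<in> carrier (coarsening_lattice m n)" "Y \<in> carrier (coarsening_lattice m n)"
  then show "shade_face m n X \<sqsubseteq>\<^bsub>face_lattice (hochschild_hull m n)\<^esub> shade_face m n Y \<longleftrightarrow>
      X \<sqsubseteq>\<^bsub>coarsening_lattice m n\<^esub> Y"
    using shade_face_subset_iff[of X m n Y] by (simp add: face_lattice_def coarsening_lattice_def)
qed (rule shade_face_bij)

theorem proposition57:
  fixes m n :: nat
  shows "hochschild_hull m n = hochschild_halfspaces m n \<and>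
    polytope (hochschild_hull m n) \<and>
    {x. x extreme_point_of hochschild_hull m n} = shade_point m n ` unary_shades m n \<and>
    lattice (coarsening_lattice m n) \<and>
    order_isomorphic (coarsening_lattice m n) (face_lattice (hochschild_hull m n))"
  using hochschild_hull_eq hochschild_halfspaces_eq polytope_hochschild extreme_points_hochschild
    lattice_coarsening order_isomorphic_coarsening by simp

end
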